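(* Let $R$ be an integral domain, $\mathbf{u}=(u_1,\dots,u_\ell)\in R^\ell$, and let $H_{\ell,n}=H_{\ell,n}^R(\mathbf{u})$ be the degenerate cyclotomic Hecke algebra of type $G(\ell,1,n)$, with standard symmetrizing form $\tau_R^{\mathrm{BK}}$ and Murphy basis $\{m_{\mathfrak{s}\mathfrak{t}}\}$. Let $\boldsymbol{\lambda}\in\mathscr{P}_{\ell,n}$ and $\mathfrak{s},\mathfrak{t}\in\mathrm{Std}(\boldsymbol{\lambda})$. Then $$\tau_R^{\mathrm{BK}}(m_{\mathfrak{s}\mathfrak{t}})=\begin{cases}1, & \text{if }\mathfrak{s}=\mathfrak{t}\text{ and } l(\mathfrak{t},i)=1\text{ for all }1\le i\le n,\\ 0,&\text{otherwise.}\end{cases}$$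
   Context: Algebra. Let $\ell,n\ge1$. $H_{\ell,n}$ is the unital associative $R$-algebra with generators $s_1,\dots,s_{n-1},L_1,\dots,L_n$ and relations: $(L_1-u_1)\cdots(L_1-u_\ell)=0$; $s_i^2=1$; $s_is_j=s_js_i$ for $1\le i<j-1<n-1$; $s_is_{i+1}s_i=s_{i+1}s_is_{i+1}$ for $1\le i<n-1$; $L_iL_k=L_kL_i$; $s_iL_l=L_ls_i$ for $l\ne i,i+1$; $L_{i+1}=s_iL_is_i+s_i$ for $1\le i<n$. $\mathfrak{S}_n$ is the symmetric group with $\sigma_i=(i,i+1)$, acting on $\{1,\dots,n\}$ from the right (in a product the left factor is applied first); elements $w\in\mathfrak{S}_n$ are regarded as elements of $H_{\ell,n}$ via $\sigma_i\mapsto s_i$. $*$ is the $R$-algebra anti-automorphism of $H_{\ell,n}$ fixing all $s_i$ and $L_j$. Form. $H_{\ell,n}$ is $R$-free with basis $\{L_1^{c_1}\cdots L_n^{c_n}w\mid w\in\mathfrak{S}_n,\ 0\le c_i\le\ell-1\}$. $\tau_R^{\mathrm{BK}}:H_{\ell,n}\to R$ is the $R$-linear map with value $1$ on the basis element with $w=1$, $c_1=\cdots=c_n=\ell-1$, and $0$ on all other basis elements. Combinatorics. $\mathscr{P}_{\ell,n}$ is the set of $\ell$-partitions $\boldsymbol{\lambda}=(\lambda^{(1)},\dots,\lambda^{(\ell)})$ of $n$; its Young diagram is $[\boldsymbol{\lambda}]=\{(r,c,l)\mid 1\le l\le\ell,\ r\ge1,\ 1\le c\le\lambda^{(l)}_r\}$.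 A $\boldsymbol{\lambda}$-tableau is a bijection $\mathfrak{t}:[\boldsymbol{\lambda}]\to\{1,\dots,n\}$; it is standard if in every component entries increase along rows and down columns. $\mathrm{Std}(\boldsymbol{\lambda})$ is the set of standard $\boldsymbol{\lambda}$-tableaux. $\mathfrak{t}^{\boldsymbol{\lambda}}$ is the tableau with $1,2,\dots,n$ entered in order along successive rows of $\lambda^{(1)}$, then $\lambda^{(2)}$, etc. $d(\mathfrak{t})\in\mathfrak{S}_n$ is the unique element with $\mathfrak{t}=\mathfrak{t}^{\boldsymbol{\lambda}}d(\mathfrak{t})$ (right action on entries). $l(\mathfrak{t},j)$ is the component of the node containing $j$: $\mathfrak{t}^{-1}(j)=(r(\mathfrak{t},j),c(\mathfrak{t},j),l(\mathfrak{t},j))$. Murphy basis. $\mathfrak{S}_{\boldsymbol{\lambda}}\le\mathfrak{S}_n$ is the Young subgroup of the composition obtained by listing all the nonzero row lengths of $\lambda^{(1)}$, then $\lambda^{(2)}$, etc. (the row stabilizer of $\mathfrak{t}^{\boldsymbol{\lambda}}$). Put $\mathfrak{a}_s=|\lambda^{(1)}|+\cdots+|\lambda^{(s-1)}|$, $\mathrm{x}_{\boldsymbol{\lambda}}=\sum_{w\in\mathfrak{S}_{\boldsymbol{\lambda}}}w$, $u^+_{\boldsymbol{\lambda}}=\prod_{s=2}^{\ell}\prod_{k=1}^{\mathfrak{a}_s}(L_k-u_s)$, $m_{\boldsymbol{\lambda}}=\mathrm{x}_{\boldsymbol{\lambda}}u^+_{\boldsymbol{\lambda}}$ and $m_{\mathfrak{s}\mathfrak{t}}=d(\mathfrak{s})^*\,m_{\boldsymbol{\lambda}}\,d(\mathfrak{t})$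 for $\mathfrak{s},\mathfrak{t}\in\mathrm{Std}(\boldsymbol{\lambda})$. *)

theory Defs
  imports
    "HOL-Algebra.QuotRing"
    "HOL-Library.Poly_Mapping"
    "HOL-Library.FuncSet"
    "HOL-Combinatorics.Permutations"
begin

section \<open>The free associative algebra\<close>

text \<open>Words are wrapped in a datatype so that they can carry the additive monoid structure
  (concatenation) that the convolution product of \<open>HOL-Library.Poly_Mapping\<close> expects.\<close>

datatype 'a fword = FWord (letters: "'a list")

instantiation fword :: (type) monoid_add
begin

definition zero_fword :: "'a fword" where
  "zero_fword = FWord []"

definition plus_fword :: "'a fword \<Rightarrow> 'a fword \<Rightarrow> 'a fword" where
  "plus_fword v w = FWord (letters v @ letters w)"

instance
  by standard (auto simp: zero_fword_def plus_fword_def)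

end

datatype hgen = GenS nat | GenL nat

type_synonym 'r free_alg = "hgen fword \<Rightarrow>\<^sub>0 'r"

definition gens :: "nat \<Rightarrow> hgen set" where
  "gens n = GenS ` {1..<n} \<union> GenL ` {1..n}"

text \<open>The free unital associative \<open>'r\<close>-algebra on \<open>s\<^sub>1, \<dots>, s\<^sub>n\<^sub>-\<^sub>1, L\<^sub>1, \<dots>, L\<^sub>n\<close>.\<close>

definition free_algebra :: "nat \<Rightarrow> 'r::comm_ring_1 free_alg ring" where
  "free_algebra n =
     \<lparr>carrier = {p. \<forall>w \<in> Poly_Mapping.keys p. set (letters w) \<subseteq> gens n},
      monoid.mult = (*), one = 1, zero = 0, add = (+)\<rparr>"

definition fscal :: "'r::comm_ring_1 \<Rightarrow> 'r free_alg" where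
  "fscal a = Poly_Mapping.single 0 a"

definition fS :: "nat \<Rightarrow> 'r::comm_ring_1 free_alg" where
  "fS i = Poly_Mapping.single (FWord [GenS i]) 1"

definition fL :: "nat \<Rightarrow> 'r::comm_ring_1 free_alg" where
  "fL j = Poly_Mapping.single (FWord [GenL j]) 1"

definition frev :: "'r::comm_ring_1 free_alg \<Rightarrow> 'r free_alg" where
  "frev = Poly_Mapping.map_key (\<lambda>w. FWord (rev (letters w)))"


section \<open>The degenerate cyclotomic Hecke algebra\<close>

text \<open>A relation \<open>x = y\<close> is recorded as \<open>x - y\<close>. Of \<open>u\<close>, only the values
  \<open>u 1, \<dots>, u \<l>\<close> are used.\<close>

definition hecke_relations :: "nat \<Rightarrow> nat \<Rightarrow> (nat \<Rightarrow> 'r::comm_ring_1) \<Rightarrow> 'r free_alg set" where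
  "hecke_relations \<l> n u =
     {prod_list (map (\<lambda>k. fL 1 - fscal (u k)) [1..<Suc \<l>])}
   \<union> {fS i * fS i - 1 | i. 1 \<le> i \<and> i < n}
   \<union> {fS i * fS j - fS j * fS i | i j. 1 \<le> i \<and> i + 1 < j \<and> j < n}
   \<union> {fS i * fS (i + 1) * fS i - fS (i + 1) * fS i * fS (i + 1) | i. 1 \<le> i \<and> i + 1 < n}
   \<union> {fL i * fL k - fL k * fL i | i k. i \<in> {1..n} \<and> k \<in> {1..n}}
   \<union> {fS i * fL k - fL k * fS i | i k. 1 \<le> i \<and> i < n \<and> k \<in> {1..n} \<and> k \<noteq> i \<and> k \<noteq> i + 1}
   \<union> {fL (i + 1) - (fS i * fL i * fS i + fS i) | i. 1 \<le> i \<and> i < n}"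

definition hecke_ideal :: "nat \<Rightarrow> nat \<Rightarrow> (nat \<Rightarrow> 'r::comm_ring_1) \<Rightarrow> 'r free_alg set" where
  "hecke_ideal \<l> n u = Idl\<^bsub>free_algebra n\<^esub> (hecke_relations \<l> n u)"

definition hecke :: "nat \<Rightarrow> nat \<Rightarrow> (nat \<Rightarrow> 'r::comm_ring_1) \<Rightarrow> 'r free_alg set ring" where
  "hecke \<l> n u = free_algebra n Quot hecke_ideal \<l> n u"

definition hclass :: "nat \<Rightarrow> nat \<Rightarrow> (nat \<Rightarrow> 'r::comm_ring_1) \<Rightarrow> 'r free_alg \<Rightarrow> 'r free_alg set" where
  "hclass \<l> n u p = hecke_ideal \<l> n u +>\<^bsub>free_algebra n\<^esub> p"

definition hscal :: "nat \<Rightarrow> nat \<Rightarrow> (nat \<Rightarrow> 'r::comm_ring_1) \<Rightarrow> 'r \<Rightarrow> 'r free_alg set" where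
  "hscal \<l> n u a = hclass \<l> n u (fscal a)"

definition hS :: "nat \<Rightarrow> nat \<Rightarrow> (nat \<Rightarrow> 'r::comm_ring_1) \<Rightarrow> nat \<Rightarrow> 'r free_alg set" where
  "hS \<l> n u i = hclass \<l> n u (fS i)"

definition hL :: "nat \<Rightarrow> nat \<Rightarrow> (nat \<Rightarrow> 'r::comm_ring_1) \<Rightarrow> nat \<Rightarrow> 'r free_alg set" where
  "hL \<l> n u j = hclass \<l> n u (fL j)"

definition hprod :: "nat \<Rightarrow> nat \<Rightarrow> (nat \<Rightarrow> 'r::comm_ring_1) \<Rightarrow> 'r free_alg set list \<Rightarrow> 'r free_alg set" where
  "hprod \<l> n u xs = foldr (\<otimes>\<^bsub>hecke \<l> n u\<^esub>) xs \<one>\<^bsub>hecke \<l> n u\<^esub>"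

text \<open>The anti-automorphism \<open>*\<close>: reversal of words maps the ideal of relations onto itself,
  hence the image of a coset under it is again a coset (\<open>hstar_hclass\<close>).\<close>

definition hstar :: "'r::comm_ring_1 free_alg set \<Rightarrow> 'r free_alg set" where
  "hstar X = frev ` X"

subsection \<open>The quotient ring and its anti-automorphism\<close>

lemma free_algebra_simps [simp]:
  "p \<in> carrier (free_algebra n) \<longleftrightarrow> (\<forall>w \<in> Poly_Mapping.keys p. set (letters w) \<subseteq> gens n)"
  "p \<otimes>\<^bsub>free_algebra n\<^esub> q = p * q" "p \<oplus>\<^bsub>free_algebra n\<^esub> q = p + q"
  "\<one>\<^bsub>free_algebra n\<^esub> = 1" "\<zero>\<^bsub>free_algebra n\<^esub> = 0"
  by (simp_all add: free_algebra_def)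

lemma free_algebra_closed:
  fixes p q :: "'r::comm_ring_1 free_alg"
  assumes "p \<in> carrier (free_algebra n)" "q \<in> carrier (free_algebra n)"
  shows "p + q \<in> carrier (free_algebra n)" "p * q \<in> carrier (free_algebra n)"
    "- p \<in> carrier (free_algebra n)" "p - q \<in> carrier (free_algebra n)"
proof -
  show "p + q \<in> carrier (free_algebra n)"
    using assms Poly_Mapping.keys_add[of p q] by auto
  show "p * q \<in> carrier (free_algebra n)"
    unfolding free_algebra_simps
  proof
    fix w assume "w \<in> Poly_Mapping.keys (p * q)"
    then obtain a b where "w = a + b" "a \<in> Poly_Mapping.keys p" "b \<in> Poly_Mapping.keys q"
      using keys_mult[of p q] by blast
    then show "set (letters w) \<subseteq> gens n"
      using assms by (simp add: plus_fword_def)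
  qed
  show "- p \<in> carrier (free_algebra n)"
    using assms by (simp add: in_keys_iff)
  show "p - q \<in> carrier (free_algebra n)"
    unfolding free_algebra_simps
  proof
    fix w assume "w \<in> Poly_Mapping.keys (p - q)"
    then have "w \<in> Poly_Mapping.keys p \<or> w \<in> Poly_Mapping.keys q"
      by (auto simp: in_keys_iff lookup_minus)
    then show "set (letters w) \<subseteq> gens n"
      using assms by auto
  qed
qed

lemma free_algebra_generators:
  "0 \<in> carrier (free_algebra n)" "1 \<in> carrier (free_algebra n)" "fscal a \<in> carrier (free_algebra n)"
  "1 \<le> i \<Longrightarrow> i < n \<Longrightarrow> fS i \<in> carrier (free_algebra n)"
  "1 \<le> j \<Longrightarrow> j \<le> n \<Longrightarrow> fL j \<in> carrier (free_algebra n)"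
  by (auto simp: fscal_def fS_def fL_def gens_def zero_fword_def split: if_splits)

lemma free_algebra_ring: "ring (free_algebra n :: 'r::comm_ring_1 free_alg ring)"
proof (rule ringI)
  show "abelian_group (free_algebra n :: 'r free_alg ring)"
  proof (rule abelian_groupI)
    show "\<exists>y\<in>carrier (free_algebra n). y \<oplus>\<^bsub>free_algebra n\<^esub> x = \<zero>\<^bsub>free_algebra n\<^esub>"
      if "x \<in> carrier (free_algebra n)" for x :: "'r free_alg"
      by (rule bexI[of _ "- x"]) (use free_algebra_closed(3)[OF that that] in auto)
  qed (use free_algebra_closed free_algebra_generators in \<open>auto simp: add_ac simp del: free_algebra_simps(1)\<close>)
  show "Group.monoid (free_algebra n :: 'r free_alg ring)"
    by (rule monoidI)
      (use free_algebra_closed free_algebra_generators in \<open>auto simp: mult.assoc simp del: free_algebra_simps(1)\<close>)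
qed (auto simp: algebra_simps)

lemma hecke_relations_closed:
  assumes "n \<ge> 1"
  shows "hecke_relations \<l> n u \<subseteq> carrier (free_algebra n)"
proof -
  have "prod_list (map (\<lambda>k. fL 1 - fscal (u k)) xs) \<in> carrier (free_algebra n)" for xs
    using assms
    by (induction xs) (auto intro!: free_algebra_closed free_algebra_generators simp del: free_algebra_simps(1))
  then show ?thesis
    unfolding hecke_relations_def
    by (auto intro!: free_algebra_closed free_algebra_generators simp del: free_algebra_simps(1))
qed

lemma hecke_ideal_ideal: "n \<ge> 1 \<Longrightarrow> ideal (hecke_ideal \<l> n u) (free_algebra n)"
  unfolding hecke_ideal_def
  using ring.genideal_ideal[OF free_algebra_ring] hecke_relations_closed by blast

lemma hecke_ring: "n \<ge> 1 \<Longrightarrow> ring (hecke \<l> n u)"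
  unfolding hecke_def by (rule ideal.quotient_is_ring[OF hecke_ideal_ideal])

lemma inj_rev_fword: "inj (\<lambda>w. FWord (rev (letters w)))"
  by (auto intro!: injI fword.expand)

lemma frev_simps [simp]:
  "frev 0 = 0" "frev (p + q) = frev p + frev q" "frev (- p) = - frev p" "frev (p - q) = frev p - frev q"
  "frev (Poly_Mapping.single w a) = Poly_Mapping.single (FWord (rev (letters w))) a"
proof -
  note r = map_key.rep_eq[OF inj_rev_fword]
  show "frev 0 = 0" "frev (p + q) = frev p + frev q" "frev (- p) = - frev p"
    "frev (p - q) = frev p - frev q"
    by (rule poly_mapping_eqI; simp add: frev_def r lookup_add lookup_minus)+
  show "frev (Poly_Mapping.single w a) = Poly_Mapping.single (FWord (rev (letters w))) a"
    using map_key_single[OF inj_rev_fword, of "FWord (rev (letters w))" a] by (simp add: frev_def)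
qed

lemma frev_frev [simp]: "frev (frev p) = p"
  by (rule poly_mapping_eqI) (simp add: frev_def map_key.rep_eq[OF inj_rev_fword])

lemma free_alg_induct:
  fixes p :: "'r::comm_ring_1 free_alg"
  assumes "P 0" "\<And>p w a. P p \<Longrightarrow> P (p + Poly_Mapping.single w a)"
  shows "P p"
proof (induction p rule: update_induct)
  case const show ?case by fact
next
  case (update f a b)
  then have "Poly_Mapping.update a b f = f + Poly_Mapping.single a b"
    by (intro poly_mapping_eqI)
      (auto simp: lookup_update lookup_add lookup_single when_def in_keys_iff)
  with update assms(2) show ?case by simp
qed

lemma frev_mult [simp]: "frev (p * q) = frev q * frev p"
proof (induction p rule: free_alg_induct)
  case (2 p w a)
  have "frev (Poly_Mapping.single w a * q) = frev q * frev (Poly_Mapping.single w a)"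
    by (induction q rule: free_alg_induct)
      (auto simp: distrib_left distrib_right mult_single plus_fword_def mult.commute)
  with 2 show ?case by (simp add: distrib_left distrib_right)
qed simp

lemma frev_generators [simp]:
  "frev 1 = 1" "frev (fscal a) = fscal a" "frev (fS i) = fS i" "frev (fL j) = fL j"
  by (simp_all add: fscal_def fS_def fL_def zero_fword_def flip: single_one)

lemma frev_closed: "p \<in> carrier (free_algebra n) \<Longrightarrow> frev p \<in> carrier (free_algebra n)"
  by (fastforce simp: frev_def keys_map_key[OF inj_rev_fword])

lemma frev_hecke_relations:
  assumes "n \<ge> 1" "p \<in> hecke_relations \<l> n u"
  shows "frev p \<in> hecke_ideal \<l> n u"
proof -
  interpret I: ideal "hecke_ideal \<l> n u" "free_algebra n" by (rule hecke_ideal_ideal) fact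
  have rel: "q \<in> hecke_ideal \<l> n u" if "q \<in> hecke_relations \<l> n u" for q
    using ring.genideal_self[OF free_algebra_ring hecke_relations_closed[OF assms(1)]] that
    by (auto simp: hecke_ideal_def)
  have neg: "- q \<in> hecke_ideal \<l> n u" if "q \<in> hecke_relations \<l> n u" for q
    using I.I_l_closed[OF rel[OF that], of "- 1"] free_algebra_closed(3)[of 1 n 1] free_algebra_generators(2)
    by simp
  have comm: "(fL 1 - fscal a) * (fL 1 - fscal b) = (fL 1 - fscal b) * (fL 1 - fscal a)" for a b :: 'a
    by (simp add: fL_def fscal_def algebra_simps mult_single)
  have "prod_list (map (\<lambda>k. fL 1 - fscal (u k)) xs) * (fL 1 - fscal b)
      = (fL 1 - fscal b) * prod_list (map (\<lambda>k. fL 1 - fscal (u k)) xs)" for xs b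
  proof (induction xs)
    case (Cons a xs)
    then show ?case
      using comm[of "u a" b] by (simp add: mult.assoc del: One_nat_def) (simp del: One_nat_def flip: mult.assoc)
  qed simp
  then have "frev (prod_list (map (\<lambda>k. fL 1 - fscal (u k)) xs)) = prod_list (map (\<lambda>k. fL 1 - fscal (u k)) xs)" for xs
    by (induction xs) simp_all
  then have "frev p = p \<or> frev p = - p"
    using assms(2) unfolding hecke_relations_def by (auto simp: mult.assoc)
  then show ?thesis
    using rel[OF assms(2)] neg[OF assms(2)] by auto
qed

lemma frev_hecke_ideal:
  assumes "n \<ge> 1" "p \<in> hecke_ideal \<l> n u"
  shows "frev p \<in> hecke_ideal \<l> n u"
proof -
  let ?J = "frev ` hecke_ideal \<l> n u"
  interpret I: ideal "hecke_ideal \<l> n u" "free_algebra n" by (rule hecke_ideal_ideal) fact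
  have neg: "- q \<in> hecke_ideal \<l> n u" if "q \<in> hecke_ideal \<l> n u" for q
    using I.I_l_closed[OF that, of "- 1"] free_algebra_closed(3)[of 1 n 1] free_algebra_generators(2)
    by simp
  have "ideal ?J (free_algebra n)"
  proof (rule idealI[OF free_algebra_ring])
    interpret R: ring "free_algebra n" by (rule free_algebra_ring)
    show "subgroup ?J (add_monoid (free_algebra n))"
    proof (rule group.subgroupI)
      show "group (add_monoid (free_algebra n))" by (rule R.add.is_group)
      show "?J \<subseteq> carrier (add_monoid (free_algebra n))"
      proof
        fix x assume "x \<in> ?J"
        then obtain h where "h \<in> hecke_ideal \<l> n u" "x = frev h" by blast
        then show "x \<in> carrier (add_monoid (free_algebra n))"
          using frev_closed[OF I.a_Hcarr] by (simp del: free_algebra_simps(1))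
      qed
      show "?J \<noteq> {}" using additive_subgroup.zero_closed[OF I.is_additive_subgroup] by blast
    next
      fix a assume "a \<in> ?J"
      then obtain h where h: "h \<in> hecke_ideal \<l> n u" "a = frev h" by blast
      then have "a \<in> carrier (free_algebra n)" using frev_closed[OF I.a_Hcarr] by simp
      then have "\<ominus>\<^bsub>free_algebra n\<^esub> a = - a"
        using free_algebra_closed(3)[of a n a]
        by (intro R.minus_equality) (simp_all del: free_algebra_simps(1))
      moreover have "- a = frev (- h)" using h by simp
      ultimately show "inv\<^bsub>add_monoid (free_algebra n)\<^esub> a \<in> ?J"
        using neg[OF h(1)] by (simp only: a_inv_def imageI)
    next
      fix a b assume "a \<in> ?J" "b \<in> ?J"
      then obtain h k where "h \<in> hecke_ideal \<l> n u" "a = frev h" "k \<in> hecke_ideal \<l> n u" "b = frev k"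
        by blast
      then show "a \<otimes>\<^bsub>add_monoid (free_algebra n)\<^esub> b \<in> ?J"
        using additive_subgroup.a_closed[OF I.is_additive_subgroup, of h k] by (intro image_eqI[of _ _ "h + k"]) simp_all
    qed
    show "x \<otimes>\<^bsub>free_algebra n\<^esub> a \<in> ?J" "a \<otimes>\<^bsub>free_algebra n\<^esub> x \<in> ?J"
      if "a \<in> ?J" "x \<in> carrier (free_algebra n)" for a x
    proof -
      from that obtain h where h: "h \<in> hecke_ideal \<l> n u" "a = frev h" by blast
      from I.I_r_closed[OF h(1) frev_closed[OF that(2)]] h
      show "x \<otimes>\<^bsub>free_algebra n\<^esub> a \<in> ?J"
        by (intro image_eqI[of _ _ "h * frev x"]) simp_all
      from I.I_l_closed[OF h(1) frev_closed[OF that(2)]] h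
      show "a \<otimes>\<^bsub>free_algebra n\<^esub> x \<in> ?J"
        by (intro image_eqI[of _ _ "frev x * h"]) simp_all
    qed
  qed
  moreover have "hecke_relations \<l> n u \<subseteq> ?J"
  proof
    fix p assume "p \<in> hecke_relations \<l> n u"
    then show "p \<in> ?J"
      by (intro image_eqI[of _ _ "frev p"] frev_hecke_relations[OF assms(1)]) simp_all
  qed
  ultimately have "hecke_ideal \<l> n u \<subseteq> ?J"
    unfolding hecke_ideal_def by (intro ring.genideal_minimal[OF free_algebra_ring])
  then obtain h where "h \<in> hecke_ideal \<l> n u" "p = frev h" using assms(2) by blast
  then show ?thesis by simp
qed

lemma hstar_hclass:
  assumes "n \<ge> 1"
  shows "hstar (hclass \<l> n u p) = hclass \<l> n u (frev p)"
proof -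
  have coset: "hclass \<l> n u q = {h + q | h. h \<in> hecke_ideal \<l> n u}" for q
    unfolding hclass_def a_r_coset_def r_coset_def by (auto simp: free_algebra_def)
  show ?thesis
    unfolding hstar_def coset
  proof (intro equalityI subsetI)
    fix x assume "x \<in> {h + frev p | h. h \<in> hecke_ideal \<l> n u}"
    then obtain h where "h \<in> hecke_ideal \<l> n u" "x = h + frev p" by blast
    then show "x \<in> frev ` {h + p | h. h \<in> hecke_ideal \<l> n u}"
      using frev_hecke_ideal[OF assms] by (intro image_eqI[of _ _ "frev h + p"]) auto
  qed (use frev_hecke_ideal[OF assms] in auto)
qed

lemma hecke_carrier: "carrier (hecke \<l> n u) = hclass \<l> n u ` carrier (free_algebra n)"
  unfolding hecke_def FactRing_def hclass_def A_RCOSETS_defs by (auto simp: a_r_coset_def r_coset_def)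

lemma hstar_generators:
  assumes "n \<ge> 1"
  shows "hstar (hS \<l> n u i) = hS \<l> n u i" "hstar (hL \<l> n u j) = hL \<l> n u j"
    "hstar (hscal \<l> n u a) = hscal \<l> n u a"
  by (simp_all add: hS_def hL_def hscal_def hstar_hclass[OF assms])

lemma hstar_anti_automorphism:
  assumes "n \<ge> 1" "X \<in> carrier (hecke \<l> n u)" "Y \<in> carrier (hecke \<l> n u)"
  shows "hstar X \<in> carrier (hecke \<l> n u)" "hstar (hstar X) = X"
    "hstar (X \<oplus>\<^bsub>hecke \<l> n u\<^esub> Y) = hstar X \<oplus>\<^bsub>hecke \<l> n u\<^esub> hstar Y"
    "hstar (X \<otimes>\<^bsub>hecke \<l> n u\<^esub> Y) = hstar Y \<otimes>\<^bsub>hecke \<l> n u\<^esub> hstar X"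
proof -
  interpret I: ideal "hecke_ideal \<l> n u" "free_algebra n" by (rule hecke_ideal_ideal) fact
  obtain p q where p: "p \<in> carrier (free_algebra n)" "X = hclass \<l> n u p"
    and q: "q \<in> carrier (free_algebra n)" "Y = hclass \<l> n u q"
    using assms by (auto simp: hecke_carrier)
  have hom: "hclass \<l> n u a \<oplus>\<^bsub>hecke \<l> n u\<^esub> hclass \<l> n u b = hclass \<l> n u (a + b)"
    "hclass \<l> n u a \<otimes>\<^bsub>hecke \<l> n u\<^esub> hclass \<l> n u b = hclass \<l> n u (a * b)"
    if "a \<in> carrier (free_algebra n)" "b \<in> carrier (free_algebra n)" for a b
    using ring_hom_add[OF I.rcos_ring_hom that] ring_hom_mult[OF I.rcos_ring_hom that]
    by (simp_all add: hecke_def hclass_def)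
  show "hstar X \<in> carrier (hecke \<l> n u)"
    using p frev_closed by (auto simp: hstar_hclass[OF assms(1)] hecke_carrier simp del: free_algebra_simps(1))
  show "hstar (hstar X) = X"
    by (simp add: hstar_def image_image)
  show "hstar (X \<oplus>\<^bsub>hecke \<l> n u\<^esub> Y) = hstar X \<oplus>\<^bsub>hecke \<l> n u\<^esub> hstar Y"
    "hstar (X \<otimes>\<^bsub>hecke \<l> n u\<^esub> Y) = hstar Y \<otimes>\<^bsub>hecke \<l> n u\<^esub> hstar X"
    using p q by (simp_all add: frev_closed hstar_hclass[OF assms(1)] hom del: free_algebra_simps(1))
qed


section \<open>Permutations as elements of the algebra\<close>

text \<open>Permutations act from the right: the left factor of a product is applied first, so the
  product \<open>v w\<close> is the function \<open>w \<circ> v\<close>, and \<open>word_perm [i\<^sub>1, \<dots>, i\<^sub>k]\<close> is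
  \<open>\<sigma>\<^bsub>i\<^sub>1\<^esub> \<cdots> \<sigma>\<^bsub>i\<^sub>k\<^esub>\<close>.\<close>

definition word_perm :: "nat list \<Rightarrow> nat \<Rightarrow> nat" where
  "word_perm is = foldr (\<lambda>i f. f \<circ> Transposition.transpose i (i + 1)) is id"

text \<open>Any expression of \<open>w\<close> in the \<open>\<sigma>\<^sub>i\<close> gives the same element, because the \<open>s\<^sub>i\<close> satisfy the
  Coxeter relations of the symmetric group.\<close>

definition hperm :: "nat \<Rightarrow> nat \<Rightarrow> (nat \<Rightarrow> 'r::comm_ring_1) \<Rightarrow> (nat \<Rightarrow> nat) \<Rightarrow> 'r free_alg set" where
  "hperm \<l> n u w =
     hprod \<l> n u (map (hS \<l> n u) (SOME is. set is \<subseteq> {1..<n} \<and> word_perm is = w))"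


section \<open>The standard symmetrizing form\<close>

definition hbasis :: "nat \<Rightarrow> nat \<Rightarrow> (nat \<Rightarrow> 'r::comm_ring_1) \<Rightarrow> (nat \<Rightarrow> nat) \<Rightarrow> (nat \<Rightarrow> nat) \<Rightarrow> 'r free_alg set" where
  "hbasis \<l> n u c w =
     hprod \<l> n u (map (\<lambda>i. hL \<l> n u i [^]\<^bsub>hecke \<l> n u\<^esub> c i) [1..<Suc n])
       \<otimes>\<^bsub>hecke \<l> n u\<^esub> hperm \<l> n u w"

text \<open>Since the elements \<open>hbasis \<l> n u c w\<close> below form an \<open>'r\<close>-basis of \<open>hecke \<l> n u\<close>, exactly one
  function on its carrier has this property.\<close>

definition is_BK_form :: "nat \<Rightarrow> nat \<Rightarrow> (nat \<Rightarrow> 'r::comm_ring_1) \<Rightarrow> ('r free_alg set \<Rightarrow> 'r) \<Rightarrow> bool" where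
  "is_BK_form \<l> n u \<tau> \<longleftrightarrow>
     (\<forall>X \<in> carrier (hecke \<l> n u). \<forall>Y \<in> carrier (hecke \<l> n u).
        \<tau> (X \<oplus>\<^bsub>hecke \<l> n u\<^esub> Y) = \<tau> X + \<tau> Y) \<and>
     (\<forall>a. \<forall>X \<in> carrier (hecke \<l> n u).
        \<tau> (hscal \<l> n u a \<otimes>\<^bsub>hecke \<l> n u\<^esub> X) = a * \<tau> X) \<and>
     (\<forall>c w. (\<forall>i \<in> {1..n}. c i \<le> \<l> - 1) \<and> w permutes {1..n} \<longrightarrow>
        \<tau> (hbasis \<l> n u c w) = (if w = id \<and> (\<forall>i \<in> {1..n}. c i = \<l> - 1) then 1 else 0))"


section \<open>Multipartitions and tableaux\<close>

text \<open>A partition is the list of its nonzero parts.\<close>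

definition is_partition :: "nat list \<Rightarrow> bool" where
  "is_partition p \<longleftrightarrow> sorted_wrt (\<ge>) p \<and> (\<forall>x \<in> set p. 0 < x)"

definition multipartitions :: "nat \<Rightarrow> nat \<Rightarrow> nat list list set" where
  "multipartitions \<l> n =
     {lam. length lam = \<l> \<and> (\<forall>p \<in> set lam. is_partition p) \<and> sum_list (map sum_list lam) = n}"

text \<open>Nodes are triples \<open>(r, c, l)\<close> (row, column, component), all counted from 1, whereas list
  positions are counted from 0.\<close>

type_synonym node = "nat \<times> nat \<times> nat"

definition diagram :: "nat list list \<Rightarrow> node set" where
  "diagram lam =
     {(r, c, l). 1 \<le> l \<and> l \<le> length lam \<and> 1 \<le> r \<and> r \<le> length (lam ! (l - 1)) \<and>
                 1 \<le> c \<and> c \<le> lam ! (l - 1) ! (r - 1)}"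

text \<open>Tableaux are extensional, so that equality of functions is equality of tableaux.\<close>

definition tableaux :: "nat list list \<Rightarrow> (node \<Rightarrow> nat) set" where
  "tableaux lam =
     {t. t \<in> extensional (diagram lam) \<and>
         bij_betw t (diagram lam) {1..sum_list (map sum_list lam)}}"

definition Std :: "nat list list \<Rightarrow> (node \<Rightarrow> nat) set" where
  "Std lam =
     {t \<in> tableaux lam.
        (\<forall>r c c' l. (r, c, l) \<in> diagram lam \<and> (r, c', l) \<in> diagram lam \<and> c < c' \<longrightarrow>
           t (r, c, l) < t (r, c', l)) \<and>
        (\<forall>r r' c l. (r, c, l) \<in> diagram lam \<and> (r', c, l) \<in> diagram lam \<and> r < r' \<longrightarrow>
           t (r, c, l) < t (r', c, l))}"

definition acharge :: "nat list list \<Rightarrow> nat \<Rightarrow> nat" where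
  "acharge lam s = sum_list (map sum_list (take (s - 1) lam))"

definition init_tableau :: "nat list list \<Rightarrow> node \<Rightarrow> nat" where
  "init_tableau lam =
     (\<lambda>(r, c, l) \<in> diagram lam. acharge lam l + sum_list (take (r - 1) (lam ! (l - 1))) + c)"

definition tab_perm :: "nat list list \<Rightarrow> (node \<Rightarrow> nat) \<Rightarrow> nat \<Rightarrow> nat" where
  "tab_perm lam t =
     (THE w. w permutes {1..sum_list (map sum_list lam)} \<and>
             (\<forall>x \<in> diagram lam. t x = w (init_tableau lam x)))"

definition tab_comp :: "nat list list \<Rightarrow> (node \<Rightarrow> nat) \<Rightarrow> nat \<Rightarrow> nat" where
  "tab_comp lam t j = (case the_inv_into (diagram lam) t j of (r, c, l) \<Rightarrow> l)"


section \<open>The Murphy basis\<close>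

definition young_subgroup :: "nat list \<Rightarrow> (nat \<Rightarrow> nat) set" where
  "young_subgroup \<mu> =
     {w. w permutes {1..sum_list \<mu>} \<and>
         (\<forall>j < length \<mu>. w ` {sum_list (take j \<mu>) <.. sum_list (take (Suc j) \<mu>)}
                         = {sum_list (take j \<mu>) <.. sum_list (take (Suc j) \<mu>)})}"

definition x_elt :: "nat \<Rightarrow> nat \<Rightarrow> (nat \<Rightarrow> 'r::comm_ring_1) \<Rightarrow> nat list list \<Rightarrow> 'r free_alg set" where
  "x_elt \<l> n u lam = (\<Oplus>\<^bsub>hecke \<l> n u\<^esub>w \<in> young_subgroup (concat lam). hperm \<l> n u w)"

definition u_elt :: "nat \<Rightarrow> nat \<Rightarrow> (nat \<Rightarrow> 'r::comm_ring_1) \<Rightarrow> nat list list \<Rightarrow> 'r free_alg set" where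
  "u_elt \<l> n u lam =
     hprod \<l> n u (map (\<lambda>s.
       hprod \<l> n u (map (\<lambda>k. hL \<l> n u k \<ominus>\<^bsub>hecke \<l> n u\<^esub> hscal \<l> n u (u s)) [1..<Suc (acharge lam s)]))
     [2..<Suc \<l>])"

definition m_elt :: "nat \<Rightarrow> nat \<Rightarrow> (nat \<Rightarrow> 'r::comm_ring_1) \<Rightarrow> nat list list \<Rightarrow> 'r free_alg set" where
  "m_elt \<l> n u lam = x_elt \<l> n u lam \<otimes>\<^bsub>hecke \<l> n u\<^esub> u_elt \<l> n u lam"

definition murphy ::
  "nat \<Rightarrow> nat \<Rightarrow> (nat \<Rightarrow> 'r::comm_ring_1) \<Rightarrow> nat list list \<Rightarrow> (node \<Rightarrow> nat) \<Rightarrow> (node \<Rightarrow> nat) \<Rightarrow> 'r free_alg set" where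
  "murphy \<l> n u lam s t =
     hstar (hperm \<l> n u (tab_perm lam s)) \<otimes>\<^bsub>hecke \<l> n u\<^esub> m_elt \<l> n u lam
       \<otimes>\<^bsub>hecke \<l> n u\<^esub> hperm \<l> n u (tab_perm lam t)"

end

theory Submission
  imports Defs "HOL-Library.Multiset"
begin

text \<open>Filter the algebra by the number of letters \<open>L\<^sub>k\<close> in a word. Modulo lower degree the \<open>s\<^sub>i\<close>
  permute the \<open>L\<^sub>k\<close>, and \<open>L\<^sub>k\<^sup>l\<close> is itself of lower degree: for \<open>k = 1\<close> this is the cyclotomic
  relation, and conjugation by \<open>s\<^sub>k\<close> carries it from \<open>k\<close> to \<open>k + 1\<close>. Hence a word of degree \<open>d\<close>
  reduces to basis elements of degree at most \<open>d\<close>, and the form vanishes in degrees below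
  \<open>n (l - 1)\<close>. The element \<open>m\<close> has degree \<open>\<Sum>\<^sub>s a\<^sub>s\<close> (over \<open>s \<ge> 2\<close>), which is smaller unless every node
  lies in the first component. In that case the leading term of \<open>u\<^sup>+\<close> is \<open>(L\<^sub>1 \<cdots> L\<^sub>n)\<^bsup>l-1\<^esup>\<close>, which
  commutes with the \<open>s\<^sub>i\<close> modulo lower degree, so that the form counts the row permutations \<open>w\<close>
  with \<open>w d(t) = d(s)\<close>; two standard tableaux with the same row sets are equal.\<close>

section \<open>The Coxeter presentation of the symmetric group\<close>

lemma word_perm_simps [simp]:
  "word_perm [] = id"
  "word_perm (i # is) = word_perm is \<circ> Transposition.transpose i (i + 1)"
  by (simp_all add: word_perm_def)

lemma word_perm_append: "word_perm (xs @ ys) = word_perm ys \<circ> word_perm xs"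
  by (induction xs) (simp_all add: o_assoc)

lemma word_perm_permutes: "set is \<subseteq> {1..<n} \<Longrightarrow> word_perm is permutes {1..n}"
  by (induction "is") (auto intro!: permutes_compose permutes_swap_id simp: permutes_id)

text \<open>Every letter is an involution, so cancellation proceeds from the middle outwards.
  Reversal thus inverts permutations, which is how \<open>*\<close> acts on them in
  \<open>murphy_value\<close>.\<close>

lemma word_perm_rev: "word_perm (rev xs) \<circ> word_perm xs = id"
proof (induction xs)
  case (Cons x xs)
  have "word_perm (rev (x # xs)) \<circ> word_perm (x # xs)
    = Transposition.transpose x (x + 1) \<circ> (word_perm (rev xs) \<circ> word_perm xs) \<circ> Transposition.transpose x (x + 1)"
    by (simp add: word_perm_append o_assoc)
  also have "\<dots> = id" unfolding Cons by (simp add: fun_eq_iff)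
  finally show ?case .
qed simp

text \<open>The leftmost letter acts first, so \<open>m\<close> is carried down one step at a time:
  \<open>m - 1\<close>, \<open>m - 2\<close>, and finally \<open>k\<close>.\<close>

lemma word_perm_descending: "k \<le> m \<Longrightarrow> word_perm (rev [k..<m]) m = k"
proof (induction m)
  case (Suc m)
  then show ?case by (cases "k = Suc m") auto
qed simp

lemma exists_word_perm: "w permutes {1..m} \<Longrightarrow> \<exists>is. set is \<subseteq> {1..<m} \<and> word_perm is = w"
proof (induction m arbitrary: w)
  case 0
  then show ?case by (intro exI[of _ "[]"]) simp
next
  case (Suc m)
  define k where "k = w (Suc m)"
  have k: "1 \<le> k" "k \<le> Suc m"
    using permutes_in_image[OF Suc.prems, of "Suc m"] by (auto simp: k_def)
  define D where "D = rev [k..<Suc m]"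
  have D: "set D \<subseteq> {1..<Suc m}" using k by (auto simp: D_def)
  \<comment> \<open>Both \<open>w\<close> and \<open>word_perm D\<close> send \<open>Suc m\<close>
    to \<open>k\<close>, and \<open>rev D\<close> represents the inverse of \<open>D\<close>. Hence
    \<open>v\<close> fixes \<open>Suc m\<close> and the induction hypothesis applies to it.\<close>
  define v where "v = word_perm (rev D) \<circ> w"
  have vp: "v permutes {1..Suc m}"
    unfolding v_def using word_perm_permutes[of "rev D" "Suc m"] D Suc.prems
    by (intro permutes_compose) auto
  have "v (Suc m) = word_perm (rev D) (word_perm D (Suc m))"
    using word_perm_descending[of k "Suc m"] k by (simp add: v_def D_def k_def)
  also have "\<dots> = Suc m" using word_perm_rev[of D] by (metis comp_apply id_apply)
  finally have "v permutes {1..m}"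
    using vp by (intro permutes_superset[OF vp]) (auto simp: atLeastAtMostSuc_conv)
  then obtain js where js: "set js \<subseteq> {1..<m}" "word_perm js = v" using Suc.IH by blast
  have "word_perm (js @ D) = (word_perm (rev (rev D)) \<circ> word_perm (rev D)) \<circ> w"
    unfolding word_perm_append js v_def by (simp add: o_assoc)
  then have "word_perm (js @ D) = w" by (simp add: word_perm_rev del: rev_rev_ident)
  then show ?case using js D by (intro exI[of _ "js @ D"]) auto
qed

section \<open>Coxeter equivalence and the word problem\<close>

inductive cox_eq :: "nat \<Rightarrow> nat list \<Rightarrow> nat list \<Rightarrow> bool" for n where
  cox_refl: "set xs \<subseteq> {1..<n} \<Longrightarrow> cox_eq n xs xs"
| cox_sym: "cox_eq n xs ys \<Longrightarrow> cox_eq n ys xs"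
| cox_trans: "cox_eq n xs ys \<Longrightarrow> cox_eq n ys zs \<Longrightarrow> cox_eq n xs zs"
| cox_append: "cox_eq n xs ys \<Longrightarrow> cox_eq n xs' ys' \<Longrightarrow> cox_eq n (xs @ xs') (ys @ ys')"
| cox_square: "1 \<le> i \<Longrightarrow> i < n \<Longrightarrow> cox_eq n [i, i] []"
| cox_commute: "1 \<le> i \<Longrightarrow> i + 1 < j \<Longrightarrow> j < n \<Longrightarrow> cox_eq n [i, j] [j, i]"
| cox_braid: "1 \<le> i \<Longrightarrow> i + 1 < n \<Longrightarrow> cox_eq n [i, i + 1, i] [i + 1, i, i + 1]"

lemma cox_eq_word_perm: "cox_eq n xs ys \<Longrightarrow> word_perm xs = word_perm ys"
  by (induction rule: cox_eq.induct)
    (auto simp: word_perm_append fun_eq_iff transpose_def split: if_splits)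

lemma cox_eq_letter_commute:
  assumes "1 \<le> j" "j < n" "set xs \<subseteq> {1..<n}" "\<forall>i\<in>set xs. i + 1 < j \<or> j + 1 < i"
  shows "cox_eq n (xs @ [j]) (j # xs)"
  using assms(3,4)
proof (induction xs)
  case Nil
  then show ?case using assms by (auto intro: cox_refl)
next
  case (Cons i xs)
  have "cox_eq n ([i] @ (xs @ [j])) ([i] @ (j # xs))"
    using Cons by (intro cox_append cox_refl) auto
  moreover have "cox_eq n [i, j] [j, i]"
    using Cons.prems assms(1,2) cox_commute[of i j n] cox_sym[OF cox_commute[of j i n]] by auto
  then have "cox_eq n ([i, j] @ xs) ([j, i] @ xs)"
    using Cons.prems by (intro cox_append cox_refl) auto
  ultimately show ?case by (auto intro: cox_trans)
qed

text \<open>Split the descending word around the letters \<open>j, j - 1\<close>. The appended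
  \<open>j\<close> commutes with the smaller letters in \<open>B\<close>, a braid move turns
  \<open>j, j - 1, j\<close> into \<open>j - 1, j, j - 1\<close>, and the leading
  \<open>j - 1\<close> commutes with the larger letters in \<open>A\<close>.\<close>

lemma cox_eq_descending_letter:
  assumes "1 \<le> k" "k < j" "j < m" "m \<le> n"
  shows "cox_eq n (rev [k..<m] @ [j]) ((j - 1) # rev [k..<m])"
proof -
  define A where "A = rev [Suc j..<m]"
  define B where "B = rev [k..<j - 1]"
  have "[k..<m] = [k..<j - 1] @ [j - 1, j] @ [Suc j..<m]"
    using assms upt_add_eq_append[of k "j - 1" "m - (j - 1)"] upt_conv_Cons[of "j - 1" m] upt_conv_Cons[of j m]
    by simp
  then have D: "rev [k..<m] = A @ [j, j - 1] @ B" by (simp add: A_def B_def)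
  have AB: "set A \<subseteq> {1..<n}" "set B \<subseteq> {1..<n}" and j: "1 \<le> j - 1" "j < n" "j - 1 < n"
    using assms by (auto simp: A_def B_def)
  note r = cox_refl[OF AB(1)] cox_refl[OF AB(2)]
  have 1: "cox_eq n (B @ [j]) (j # B)"
    using assms AB by (intro cox_eq_letter_commute) (auto simp: B_def)
  have 2: "cox_eq n (A @ [j - 1]) ((j - 1) # A)"
    using assms AB by (intro cox_eq_letter_commute) (auto simp: A_def)
  have 3: "cox_eq n [j, j - 1, j] [j - 1, j, j - 1]"
    using cox_sym[OF cox_braid[of "j - 1" n]] assms by simp
  have "cox_eq n (A @ [j, j - 1] @ (B @ [j])) (A @ [j, j - 1] @ (j # B))"
    by (intro cox_append r 1 cox_refl) (use j in auto)
  moreover have "cox_eq n (A @ [j, j - 1, j] @ B) (A @ [j - 1, j, j - 1] @ B)"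
    by (intro cox_append r 3)
  moreover have "cox_eq n ((A @ [j - 1]) @ [j, j - 1] @ B) (((j - 1) # A) @ [j, j - 1] @ B)"
    by (intro cox_append r 2 cox_refl) (use j in auto)
  ultimately show ?thesis
    unfolding D by (auto intro: cox_trans)
qed

text \<open>The words \<open>rev [k..<Suc m]\<close> represent the cosets of the symmetric group on \<open>m\<close> letters in
  that on \<open>m + 1\<close> letters; the coset is recognised by the image \<open>k\<close> of \<open>m + 1\<close>.\<close>

lemma cox_eq_coset_form:
  assumes "Suc m \<le> n" "set xs \<subseteq> {1..<Suc m}"
  shows "\<exists>ys k. set ys \<subseteq> {1..<m} \<and> 1 \<le> k \<and> k \<le> Suc m \<and> cox_eq n xs (ys @ rev [k..<Suc m])"
  using assms(2)
proof (induction xs rule: rev_induct)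
  case Nil
  then show ?case by (intro exI[of _ "[]"] exI[of _ "Suc m"]) (auto intro: cox_refl)
next
  case (snoc j xs)
  then obtain ys k where ys: "set ys \<subseteq> {1..<m}" "1 \<le> k" "k \<le> Suc m"
    and eq: "cox_eq n xs (ys @ rev [k..<Suc m])" by auto
  have j: "1 \<le> j" "j \<le> m" "j < n" using snoc.prems assms by auto
  have "cox_eq n (xs @ [j]) ((ys @ rev [k..<Suc m]) @ [j])"
    using eq j by (intro cox_append cox_refl) auto
  then have eq': "cox_eq n (xs @ [j]) (ys @ (rev [k..<Suc m] @ [j]))" by simp
  have step: ?case if "cox_eq n (rev [k..<Suc m] @ [j]) (zs @ rev [k'..<Suc m])"
    "set zs \<subseteq> {1..<m}" "1 \<le> k'" "k' \<le> Suc m" for zs k'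
  proof -
    have "cox_eq n (ys @ (rev [k..<Suc m] @ [j])) (ys @ (zs @ rev [k'..<Suc m]))"
      by (rule cox_append[OF cox_refl that(1)]) (use ys assms in auto)
    then show ?thesis using cox_trans[OF eq'] that ys
      by (intro exI[of _ "ys @ zs"] exI[of _ k']) (auto simp del: upt_Suc)
  qed
  \<comment> \<open>The appended letter commutes past the coset word, lengthens it, cancels its last
    letter, or passes through it by a braid move and emerges on the left as
    \<open>j - 1\<close>.\<close>
  consider "j + 1 < k" | "j + 1 = k" | "j = k" | "k < j" by linarith
  then show ?case
  proof cases
    case 1
    then have "cox_eq n (rev [k..<Suc m] @ [j]) ([j] @ rev [k..<Suc m])"
      using cox_eq_letter_commute[of j n "rev [k..<Suc m]"] j ys assms by (auto simp del: upt_Suc)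
    then show ?thesis using 1 ys j by (intro step[of "[j]" k]) auto
  next
    case 2
    then have "rev [k..<Suc m] @ [j] = rev [j..<Suc m]"
      using j by (simp add: upt_conv_Cons[of j])
    moreover have "cox_eq n \<dots> \<dots>"
      using j assms by (intro cox_refl) auto
    ultimately show ?thesis using j by (intro step[of "[]" j]) auto
  next
    case 3
    have "cox_eq n (rev [Suc k..<Suc m] @ [k, k]) (rev [Suc k..<Suc m] @ [])"
      using j assms 3 by (intro cox_append cox_refl cox_square) auto
    moreover have "rev [k..<Suc m] @ [j] = rev [Suc k..<Suc m] @ [k, k]"
      using j 3 by (simp add: upt_conv_Cons[of k])
    ultimately show ?thesis using j 3 by (intro step[of "[]" "Suc k"]) auto
  next
    case 4
    then show ?thesis
      using cox_eq_descending_letter[of k j "Suc m" n] ys j assms by (intro step[of "[j - 1]" k]) auto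
  qed
qed

text \<open>Put both words in coset form. The image of \<open>Suc m\<close> determines the coset
  word, which can then be cancelled, leaving words on fewer letters for the induction. This makes
  the choice of a word in \<open>hperm\<close> immaterial.\<close>

lemma cox_eq_if_word_perm_eq:
  assumes "m \<le> n" "set xs \<subseteq> {1..<m}" "set ys \<subseteq> {1..<m}" "word_perm xs = word_perm ys"
  shows "cox_eq n xs ys"
  using assms
proof (induction m arbitrary: xs ys)
  case 0
  then show ?case by (auto intro: cox_refl)
next
  case (Suc m)
  obtain xs' k where x: "set xs' \<subseteq> {1..<m}" "1 \<le> k" "k \<le> Suc m"
    and xeq: "cox_eq n xs (xs' @ rev [k..<Suc m])"
    using cox_eq_coset_form Suc.prems by blast
  obtain ys' k' where y: "set ys' \<subseteq> {1..<m}" "1 \<le> k'" "k' \<le> Suc m"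
    and yeq: "cox_eq n ys (ys' @ rev [k'..<Suc m])"
    using cox_eq_coset_form Suc.prems by blast
  have fixed: "word_perm zs (Suc m) = Suc m" if "set zs \<subseteq> {1..<m}" for zs
    using permutes_not_in[OF word_perm_permutes[OF that]] by simp
  have eq: "word_perm (xs' @ rev [k..<Suc m]) = word_perm (ys' @ rev [k'..<Suc m])"
    using cox_eq_word_perm[OF xeq] cox_eq_word_perm[OF yeq] Suc.prems(4) by simp
  have "k = k'"
    using fun_cong[OF eq, of "Suc m"] fixed[OF x(1)] fixed[OF y(1)]
      word_perm_descending[OF x(3)] word_perm_descending[OF y(3)]
    by (simp add: word_perm_append del: upt_Suc)
  have cancel: "word_perm (rev D) \<circ> word_perm (zs @ D) = word_perm zs" for D zs
    by (simp add: word_perm_append o_assoc word_perm_rev)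
  have "word_perm xs' = word_perm ys'"
    using eq cancel[of "rev [k..<Suc m]"] \<open>k = k'\<close> by metis
  then have "cox_eq n xs' ys'" using Suc.IH x y Suc.prems by simp
  then have "cox_eq n (xs' @ rev [k..<Suc m]) (ys' @ rev [k'..<Suc m])"
    using \<open>k = k'\<close> x Suc.prems by (intro cox_append) (auto intro!: cox_refl)
  then show ?case using xeq yeq cox_trans cox_sym by blast
qed

section \<open>Computing in the Hecke algebra modulo lower degree\<close>

declare free_algebra_simps(1) [simp del]

section \<open>Words in the generators and their degree in the \<open>L_k\<close>\<close>

definition ldeg :: "hgen list \<Rightarrow> nat" where
  "ldeg v = length (filter (\<lambda>g. \<exists>k. g = GenL k) v)"

lemma ldeg_simps [simp]:
  "ldeg [] = 0" "ldeg (GenS i # v) = ldeg v" "ldeg (GenL k # v) = Suc (ldeg v)"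
  "ldeg (v @ w) = ldeg v + ldeg w"
  by (simp_all add: ldeg_def)

definition fgen :: "hgen \<Rightarrow> 'r::comm_ring_1 free_alg" where
  "fgen g = Poly_Mapping.single (FWord [g]) 1"

lemma fgen_simps [simp]: "fgen (GenS i) = fS i" "fgen (GenL k) = fL k"
  by (simp_all add: fgen_def fS_def fL_def)

lemma single_fword: "Poly_Mapping.single (FWord v) a = fscal a * prod_list (map fgen v)"
proof -
  have "prod_list (map fgen v) = Poly_Mapping.single (FWord v) (1::'a)"
    by (induction v) (simp_all add: fgen_def mult_single plus_fword_def zero_fword_def flip: single_one)
  then show ?thesis by (simp add: fscal_def mult_single zero_fword_def plus_fword_def)
qed

definition sword :: "nat list \<Rightarrow> 'r::comm_ring_1 free_alg" where
  "sword is = prod_list (map fS is)"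

definition lword :: "nat list \<Rightarrow> 'r::comm_ring_1 free_alg" where
  "lword ks = prod_list (map fL ks)"

lemma sword_simps [simp]:
  "sword [] = 1" "sword (i # is) = fS i * sword is" "sword (is @ js) = sword is * sword js"
  by (simp_all add: sword_def)

lemma lword_simps [simp]:
  "lword [] = 1" "lword (k # ks) = fL k * lword ks" "lword (ks @ ks') = lword ks * lword ks'"
  by (simp_all add: lword_def)

text \<open>Translates the ordered monomials of \<open>hbasis\<close> into words, where they can be
  compared by multiplicities of letters.\<close>

lemma lword_concat_replicate:
  "lword (concat (map (\<lambda>i. replicate (c i) i) ks)) = prod_list (map (\<lambda>i. fL i ^ c i) ks)"
  by (induction ks) (simp_all add: lword_def)

lemma frev_sword: "frev (sword is) = sword (rev is)"
  by (induction "is") simp_all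

text \<open>The \<open>SOME\<close> term is literally the one inside \<open>hperm\<close>, so that
  \<open>hperm\<close> folds to the class of \<open>sword (pword n w)\<close>.\<close>

definition pword :: "nat \<Rightarrow> (nat \<Rightarrow> nat) \<Rightarrow> nat list" where
  "pword n w = (SOME is. set is \<subseteq> {1..<n} \<and> word_perm is = w)"

lemma pword:
  assumes "w permutes {1..n}"
  shows "set (pword n w) \<subseteq> {1..<n}" "word_perm (pword n w) = w"
  using someI_ex[OF exists_word_perm[OF assms]] by (auto simp: pword_def)

section \<open>Cosets handled through representatives in the free algebra\<close>

locale degenerate_hecke =
  fixes l n :: nat and u :: "nat \<Rightarrow> 'r::comm_ring_1"
  assumes n_pos: "n \<ge> 1"
begin

abbreviation A :: "'r free_alg set" where "A \<equiv> carrier (free_algebra n)"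
abbreviation I :: "'r free_alg set" where "I \<equiv> hecke_ideal l n u"
abbreviation H :: "'r free_alg set ring" where "H \<equiv> hecke l n u"

lemma A_uminus: "p \<in> A \<Longrightarrow> - p \<in> A"
  using free_algebra_closed(3)[of p n p] .

lemmas A_closed = free_algebra_closed(1,2,4)[where n = n] A_uminus free_algebra_generators[where n = n]

lemma ideal_facts:
  shows ideal_A: "p \<in> I \<Longrightarrow> p \<in> A"
    and ideal_zero: "0 \<in> I"
    and ideal_add: "p \<in> I \<Longrightarrow> q \<in> I \<Longrightarrow> p + q \<in> I"
    and ideal_mult_left: "p \<in> I \<Longrightarrow> x \<in> A \<Longrightarrow> x * p \<in> I"
    and ideal_mult_right: "p \<in> I \<Longrightarrow> x \<in> A \<Longrightarrow> p * x \<in> I"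
    and ideal_minus: "p \<in> I \<Longrightarrow> - p \<in> I"
proof -
  interpret J: ideal I "free_algebra n" by (rule hecke_ideal_ideal[OF n_pos])
  show "p \<in> A" if "p \<in> I" using J.a_Hcarr that by blast
  show "0 \<in> I" using additive_subgroup.zero_closed[OF J.is_additive_subgroup] by simp
  show "p + q \<in> I" if "p \<in> I" "q \<in> I"
    using additive_subgroup.a_closed[OF J.is_additive_subgroup that] by simp
  show "x * p \<in> I" if "p \<in> I" "x \<in> A" using J.I_l_closed[OF that] by simp
  show "p * x \<in> I" if "p \<in> I" "x \<in> A" using J.I_r_closed[OF that] by simp
  show "- p \<in> I" if "p \<in> I"
    using J.I_l_closed[OF that, of "- 1"] A_uminus[OF A_closed(6)] by simp
qed

lemma relation_in_ideal: "p \<in> hecke_relations l n u \<Longrightarrow> p \<in> I"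
  using ring.genideal_self[OF free_algebra_ring hecke_relations_closed[OF n_pos]]
  by (auto simp: hecke_ideal_def)

lemma prod_list_A: "(\<And>x. x \<in> set xs \<Longrightarrow> f x \<in> A) \<Longrightarrow> prod_list (map f xs) \<in> A"
  by (induction xs) (auto intro: A_closed)

lemma sum_A: "(\<And>x. x \<in> X \<Longrightarrow> f x \<in> A) \<Longrightarrow> sum f X \<in> A"
  by (induction X rule: infinite_finite_induct) (auto intro: A_closed)

lemma sword_A: "set is \<subseteq> {1..<n} \<Longrightarrow> sword is \<in> A"
  unfolding sword_def by (intro prod_list_A A_closed) auto

lemma lword_A: "set ks \<subseteq> {1..n} \<Longrightarrow> lword ks \<in> A"
  unfolding lword_def by (intro prod_list_A A_closed) auto

lemma hclass_altdef: "hclass l n u q = {h + q | h. h \<in> I}"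
  unfolding hclass_def a_r_coset_def r_coset_def by (auto simp: free_algebra_def)

lemma hclass_cong:
  assumes "p - q \<in> I"
  shows "hclass l n u p = hclass l n u q"
proof -
  have *: "hclass l n u p \<subseteq> hclass l n u q" if "p - q \<in> I" for p q :: "'r free_alg"
  proof
    fix x assume "x \<in> hclass l n u p"
    then obtain h where "h \<in> I" "x = h + p" by (auto simp: hclass_altdef)
    then show "x \<in> hclass l n u q"
      unfolding hclass_altdef using ideal_add[OF _ that] by (auto intro!: exI[of _ "h + (p - q)"])
  qed
  have "q - p \<in> I" using ideal_minus[OF assms] by simp
  then show ?thesis using *[OF assms] * by blast
qed

lemma hclass_carrier: "p \<in> A \<Longrightarrow> hclass l n u p \<in> carrier H"
  by (auto simp: hecke_carrier)

lemma hclass_hom: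
  shows hclass_add: "p \<in> A \<Longrightarrow> q \<in> A \<Longrightarrow> hclass l n u p \<oplus>\<^bsub>H\<^esub> hclass l n u q = hclass l n u (p + q)"
    and hclass_mult: "p \<in> A \<Longrightarrow> q \<in> A \<Longrightarrow> hclass l n u p \<otimes>\<^bsub>H\<^esub> hclass l n u q = hclass l n u (p * q)"
    and hclass_one: "\<one>\<^bsub>H\<^esub> = hclass l n u 1"
    and hclass_zero: "\<zero>\<^bsub>H\<^esub> = hclass l n u 0"
proof -
  interpret J: ideal I "free_algebra n" by (rule hecke_ideal_ideal[OF n_pos])
  show "hclass l n u p \<oplus>\<^bsub>H\<^esub> hclass l n u q = hclass l n u (p + q)" if "p \<in> A" "q \<in> A"
    using ring_hom_add[OF J.rcos_ring_hom that] by (simp add: hecke_def hclass_def)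
  show "hclass l n u p \<otimes>\<^bsub>H\<^esub> hclass l n u q = hclass l n u (p * q)" if "p \<in> A" "q \<in> A"
    using ring_hom_mult[OF J.rcos_ring_hom that] by (simp add: hecke_def hclass_def)
  show "\<one>\<^bsub>H\<^esub> = hclass l n u 1"
    by (simp add: hecke_def hclass_def FactRing_def)
  show "\<zero>\<^bsub>H\<^esub> = hclass l n u 0"
    by (auto simp: hecke_def hclass_altdef FactRing_def)
qed

lemma hclass_diff:
  assumes "p \<in> A" "q \<in> A"
  shows "hclass l n u p \<ominus>\<^bsub>H\<^esub> hclass l n u q = hclass l n u (p - q)"
proof -
  interpret H: ring H by (rule hecke_ring[OF n_pos])
  have "\<ominus>\<^bsub>H\<^esub> hclass l n u q = hclass l n u (- q)"
    using assms A_uminus[of q]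
    by (intro H.minus_equality) (auto simp: hclass_hom hclass_carrier)
  then show ?thesis
    using assms A_uminus[of q] by (simp add: a_minus_def hclass_add)
qed

lemma hclass_pow: "p \<in> A \<Longrightarrow> hclass l n u p [^]\<^bsub>H\<^esub> k = hclass l n u (p ^ k) \<and> p ^ k \<in> A"
proof (induction k)
  case 0
  then show ?case by (simp add: hclass_one nat_pow_def A_closed)
next
  case (Suc k)
  then show ?case
    using Group.monoid.nat_pow_Suc[OF ring.axioms(2)[OF hecke_ring[OF n_pos]]]
    by (auto simp: hclass_mult power_Suc2 A_closed simp del: power_Suc)
qed

lemma hclass_prod_list:
  "(\<And>x. x \<in> set xs \<Longrightarrow> f x \<in> A) \<Longrightarrow>
     hprod l n u (map (\<lambda>x. hclass l n u (f x)) xs) = hclass l n u (prod_list (map f xs))"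
  by (induction xs) (auto simp: hprod_def hclass_one hclass_mult prod_list_A)

lemma hclass_sum:
  assumes "finite X" "\<And>x. x \<in> X \<Longrightarrow> f x \<in> A"
  shows "(\<Oplus>\<^bsub>H\<^esub>x\<in>X. hclass l n u (f x)) = hclass l n u (sum f X)"
proof -
  interpret H: ring H by (rule hecke_ring[OF n_pos])
  show ?thesis using assms
  proof (induction X rule: finite_induct)
    case (insert x X)
    then show ?case
      by (subst H.finsum_insert) (auto simp: Pi_def hclass_carrier hclass_add sum_A)
  qed (simp add: hclass_zero)
qed

lemma hperm_eq:
  assumes "w permutes {1..n}"
  shows "hperm l n u w = hclass l n u (sword (pword n w))"
proof -
  have "fS i \<in> A" if "i \<in> set (pword n w)" for i
    using pword(1)[OF assms] that by (intro A_closed) auto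
  then show ?thesis
    unfolding hperm_def hS_def sword_def pword_def[symmetric] by (rule hclass_prod_list)
qed

text \<open>The generating rules of \<open>cox_eq\<close> are defining relations of the algebra; a
  concatenation is handled by telescoping the difference of two products. Membership in
  \<open>A\<close> is carried along because the ideal absorbs only factors from
  \<open>A\<close>.\<close>

lemma cox_eq_sword: "cox_eq n xs ys \<Longrightarrow> sword xs - sword ys \<in> I \<and> sword xs \<in> A \<and> sword ys \<in> A"
proof (induction rule: cox_eq.induct)
  case (cox_refl xs)
  then show ?case by (simp add: ideal_zero sword_A)
next
  case (cox_sym xs ys)
  then show ?case using ideal_minus[of "sword xs - sword ys"] by simp
next
  case (cox_trans xs ys zs)
  then show ?case using ideal_add[of "sword xs - sword ys" "sword ys - sword zs"] by simp
next
  case (cox_append xs ys xs' ys')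
  have "sword (xs @ xs') - sword (ys @ ys')
      = (sword xs - sword ys) * sword xs' + sword ys * (sword xs' - sword ys')"
    by (simp add: algebra_simps)
  also have "\<dots> \<in> I" using cox_append by (intro ideal_add ideal_mult_left ideal_mult_right) auto
  finally show ?case using cox_append by (auto intro: A_closed)
next
  case (cox_square i)
  then have "fS i * fS i - 1 \<in> I" by (intro relation_in_ideal) (auto simp: hecke_relations_def)
  then show ?case using cox_square by (auto intro!: A_closed)
next
  case (cox_commute i j)
  then have "fS i * fS j - fS j * fS i \<in> I"
    by (intro relation_in_ideal) (auto simp: hecke_relations_def simp del: One_nat_def)
  then show ?case using cox_commute by (auto intro!: A_closed)
next
  case (cox_braid i)
  then have "fS i * fS (i + 1) * fS i - fS (i + 1) * fS i * fS (i + 1) \<in> I"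
    by (intro relation_in_ideal) (auto simp: hecke_relations_def simp del: One_nat_def)
  then show ?case using cox_braid by (auto intro!: A_closed simp: mult.assoc)
qed

section \<open>The filtration by degree in the \<open>L_k\<close>\<close>

definition filt :: "nat \<Rightarrow> 'r free_alg set" where
  "filt d = {p. \<exists>q \<in> A. (\<forall>w \<in> Poly_Mapping.keys q. ldeg (letters w) < d) \<and> p - q \<in> I}"

lemma filtI: "q \<in> A \<Longrightarrow> (\<And>w. w \<in> Poly_Mapping.keys q \<Longrightarrow> ldeg (letters w) < d) \<Longrightarrow> p - q \<in> I \<Longrightarrow> p \<in> filt d"
  by (auto simp: filt_def)

lemma filt_A: "p \<in> filt d \<Longrightarrow> p \<in> A"
proof -
  assume "p \<in> filt d"
  then obtain q where "q \<in> A" "p - q \<in> I" by (auto simp: filt_def)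
  then show "p \<in> A" using A_closed(1)[of "p - q" q] ideal_A by simp
qed

lemma filt_mono: "p \<in> filt d \<Longrightarrow> d \<le> e \<Longrightarrow> p \<in> filt e"
  unfolding filt_def by force

lemma ideal_filt: "p \<in> I \<Longrightarrow> p \<in> filt d"
  by (rule filtI[of 0]) (auto intro: A_closed)

text \<open>The bound in \<open>filt\<close> is strict, so at level 0 the only admissible
  representative is 0. An element of degree at most \<open>d\<close> accordingly lies in
  \<open>filt (Suc d)\<close>, which is the source of the \<open>Suc\<close> in the lemmas
  below.\<close>

lemma filt_0: "p \<in> filt 0 \<longleftrightarrow> p \<in> I"
proof
  assume "p \<in> filt 0"
  then obtain q where "Poly_Mapping.keys q = {}" "p - q \<in> I" by (auto simp: filt_def)
  then show "p \<in> I" by simp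
qed (rule ideal_filt)

lemma filt_add:
  assumes "p \<in> filt d" "q \<in> filt d"
  shows "p + q \<in> filt d"
proof -
  obtain p' where p': "p' \<in> A" "\<forall>w \<in> Poly_Mapping.keys p'. ldeg (letters w) < d" "p - p' \<in> I"
    using assms by (auto simp: filt_def)
  obtain q' where q': "q' \<in> A" "\<forall>w \<in> Poly_Mapping.keys q'. ldeg (letters w) < d" "q - q' \<in> I"
    using assms by (auto simp: filt_def)
  have "p + q - (p' + q') = (p - p') + (q - q')" by simp
  with p' q' show ?thesis
    using Poly_Mapping.keys_add[of p' q']
    by (intro filtI[of "p' + q'"]) (auto intro: A_closed simp only: ideal_add)
qed

text \<open>Strict bounds \<open>a\<close> and \<open>b\<close> mean degrees at most
  \<open>a - 1\<close> and \<open>b - 1\<close>, so a product of words has degree at most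
  \<open>a + b - 2\<close>. This is below \<open>c\<close> exactly under the stated
  inequality.\<close>

lemma filt_mult:
  assumes "p \<in> filt a" "q \<in> filt b" "a + b \<le> Suc c"
  shows "p * q \<in> filt c"
proof -
  obtain p' where p': "p' \<in> A" "\<forall>w \<in> Poly_Mapping.keys p'. ldeg (letters w) < a" "p - p' \<in> I"
    using assms by (auto simp: filt_def)
  obtain q' where q': "q' \<in> A" "\<forall>w \<in> Poly_Mapping.keys q'. ldeg (letters w) < b" "q - q' \<in> I"
    using assms by (auto simp: filt_def)
  have "p * q - p' * q' = (p - p') * q + p' * (q - q')" by (simp add: algebra_simps)
  moreover have "\<dots> \<in> I"
    using p' q' filt_A[OF assms(2)] by (intro ideal_add ideal_mult_left ideal_mult_right)
  moreover have "ldeg (letters w) < c" if w: "w \<in> Poly_Mapping.keys (p' * q')" for w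
  proof -
    obtain x y where "w = x + y" "x \<in> Poly_Mapping.keys p'" "y \<in> Poly_Mapping.keys q'"
      using subsetD[OF keys_mult[of p' q'] w] by blast
    then have "ldeg (letters x) < a" "ldeg (letters y) < b" "ldeg (letters w) = ldeg (letters x) + ldeg (letters y)"
      using p' q' by (auto simp: plus_fword_def)
    then show ?thesis using assms(3) by linarith
  qed
  ultimately show ?thesis using A_closed(2)[OF p'(1) q'(1)] by (intro filtI[of "p' * q'"]) auto
qed

lemma filt_generators:
  shows filt_fscal: "fscal a \<in> filt (Suc 0)"
    and filt_one: "1 \<in> filt (Suc 0)"
    and filt_fS: "1 \<le> i \<Longrightarrow> i < n \<Longrightarrow> fS i \<in> filt (Suc 0)"
    and filt_fL: "1 \<le> k \<Longrightarrow> k \<le> n \<Longrightarrow> fL k \<in> filt (Suc (Suc 0))"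
proof -
  have *: "p \<in> filt d" if "p \<in> A" "\<And>w. w \<in> Poly_Mapping.keys p \<Longrightarrow> ldeg (letters w) < d" for p d
    using that by (intro filtI[of p]) (auto simp: ideal_zero)
  show "fscal a \<in> filt (Suc 0)"
    by (rule *[OF free_algebra_generators(3)]) (auto simp: fscal_def zero_fword_def split: if_splits)
  show "1 \<in> filt (Suc 0)"
    by (rule *[OF free_algebra_generators(2)]) (auto simp: zero_fword_def)
  show "fS i \<in> filt (Suc 0)" if "1 \<le> i" "i < n"
    using that by (intro * A_closed) (auto simp: fS_def)
  show "fL k \<in> filt (Suc (Suc 0))" if "1 \<le> k" "k \<le> n"
    using that by (intro * A_closed) (auto simp: fL_def)
qed

lemma filt_minus: "p \<in> filt d \<Longrightarrow> - p \<in> filt d"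
proof -
  have "fscal (- 1) = (- 1 :: 'r free_alg)"
    by (simp add: fscal_def single_uminus)
  moreover assume "p \<in> filt d"
  ultimately show "- p \<in> filt d" using filt_mult[OF filt_fscal[of "- 1"], of p d d] by simp
qed

lemma filt_diff: "p \<in> filt d \<Longrightarrow> q \<in> filt d \<Longrightarrow> p - q \<in> filt d"
  using filt_add[of p d "- q"] filt_minus by simp

lemma filt_sword: "set is \<subseteq> {1..<n} \<Longrightarrow> sword is \<in> filt (Suc 0)"
  by (induction "is") (auto intro: filt_one filt_mult[OF filt_fS])

lemma filt_lword: "set ks \<subseteq> {1..n} \<Longrightarrow> lword ks \<in> filt (Suc (length ks))"
  by (induction ks) (auto intro: filt_one filt_mult[OF filt_fL])

text \<open>Congruence modulo the words with fewer than \<open>d\<close> letters \<open>L\<close>; for \<open>d = 0\<close> this is equality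
  in the Hecke algebra.\<close>

definition eqm :: "nat \<Rightarrow> 'r free_alg \<Rightarrow> 'r free_alg \<Rightarrow> bool" where
  "eqm d p q \<longleftrightarrow> p - q \<in> filt d"

lemma eqm_refl [simp]: "eqm d p p"
  by (simp add: eqm_def ideal_filt ideal_zero)

lemma eqm_sym: "eqm d p q \<Longrightarrow> eqm d q p"
  using filt_minus by (fastforce simp: eqm_def)

lemma eqm_trans [trans]: "eqm d p q \<Longrightarrow> eqm d q r \<Longrightarrow> eqm d p r"
  using filt_add[of "p - q" d "q - r"] by (simp add: eqm_def)

lemma eqm_mono: "eqm d p q \<Longrightarrow> d \<le> e \<Longrightarrow> eqm e p q"
  by (auto simp: eqm_def intro: filt_mono)

lemma eqm_mult_left: "eqm d p q \<Longrightarrow> r \<in> filt e \<Longrightarrow> d + e \<le> Suc c \<Longrightarrow> eqm c (r * p) (r * q)"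
  using filt_mult[of r e "p - q" d c] by (simp add: eqm_def right_diff_distrib)

lemma eqm_mult_right: "eqm d p q \<Longrightarrow> r \<in> filt e \<Longrightarrow> d + e \<le> Suc c \<Longrightarrow> eqm c (p * r) (q * r)"
  using filt_mult[of "p - q" d r e c] by (simp add: eqm_def left_diff_distrib)

lemma eqm_filt: "eqm d p q \<Longrightarrow> q \<in> filt d \<Longrightarrow> p \<in> filt d"
  using filt_add[of "p - q" d q] by (simp add: eqm_def)

lemma eqm_ideal: "p - q \<in> I \<Longrightarrow> eqm d p q"
  by (auto simp: eqm_def intro: ideal_filt)

lemma eqm_sword:
  assumes "set xs \<subseteq> {1..<n}" "set ys \<subseteq> {1..<n}" "word_perm xs = word_perm ys"
  shows "eqm 0 (sword xs) (sword ys)"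
  using cox_eq_sword[OF cox_eq_if_word_perm_eq[OF _ assms]] by (auto intro: eqm_ideal)

section \<open>Moving the \<open>s_i\<close> past the \<open>L_k\<close>\<close>

lemma fL_commute:
  assumes "i \<in> {1..n}" "k \<in> {1..n}"
  shows "eqm d (fL i * fL k) (fL k * fL i)"
  using assms by (intro eqm_ideal relation_in_ideal, unfold hecke_relations_def) blast

lemma fS_square:
  assumes "1 \<le> i" "i < n"
  shows "eqm d (fS i * fS i) 1"
  using assms by (intro eqm_ideal relation_in_ideal, unfold hecke_relations_def) blast

text \<open>Multiplying the relation for \<open>L_(i+1)\<close> by \<open>s_i\<close> on either side
  gives \<open>s_i L_i = L_(i+1) s_i - 1\<close> and \<open>s_i L_(i+1) = L_i s_i + 1\<close>. The
  constants have degree 0 and vanish modulo \<open>filt 1\<close>. The identities \<open>eq\<close>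
  in the proof write the differences as explicit ideal members plus these constants.\<close>

lemma fS_fL:
  assumes i: "1 \<le> i" "i < n" and k: "k \<in> {1..n}"
  shows "eqm 1 (fS i * fL k) (fL (Transposition.transpose i (i + 1) k) * fS i)"
proof -
  have S: "fS i \<in> filt (Suc 0)" using i by (rule filt_fS)
  have LA: "fL i \<in> A" and SA: "fS i \<in> A" using i by (auto intro: A_closed)
  have rel: "fL (i + 1) - (fS i * fL i * fS i + fS i) \<in> I"
    using i by (intro relation_in_ideal) (auto simp: hecke_relations_def simp del: One_nat_def)
  have sq: "fS i * fS i - 1 \<in> I"
    using i by (intro relation_in_ideal) (auto simp: hecke_relations_def)
  have 1: "eqm 1 (fS i * fL i) (fL (i + 1) * fS i)"
  proof -
    have eq: "fS i * fL i - fL (i + 1) * fS i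
        = - ((fL (i + 1) - (fS i * fL i * fS i + fS i)) * fS i + fS i * fL i * (fS i * fS i - 1)
            + (fS i * fS i - 1)) - 1"
      by (simp add: algebra_simps)
    have "(fL (i + 1) - (fS i * fL i * fS i + fS i)) * fS i + fS i * fL i * (fS i * fS i - 1)
            + (fS i * fS i - 1) \<in> I"
      by (rule ideal_add[OF ideal_add[OF ideal_mult_right[OF rel SA]
            ideal_mult_left[OF sq A_closed(2)[OF SA LA]]] sq])
    from filt_diff[OF ideal_filt[OF ideal_minus[OF this]] filt_one]
    show ?thesis unfolding eqm_def eq by simp
  qed
  have 2: "eqm 1 (fS i * fL (i + 1)) (fL i * fS i)"
  proof -
    have eq: "fS i * fL (i + 1) - fL i * fS i
        = (fS i * (fL (i + 1) - (fS i * fL i * fS i + fS i)) + (fS i * fS i - 1) * (fL i * fS i)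
            + (fS i * fS i - 1)) + 1"
      by (simp add: algebra_simps)
    have "fS i * (fL (i + 1) - (fS i * fL i * fS i + fS i)) + (fS i * fS i - 1) * (fL i * fS i)
            + (fS i * fS i - 1) \<in> I"
      by (rule ideal_add[OF ideal_add[OF ideal_mult_left[OF rel SA]
            ideal_mult_right[OF sq A_closed(2)[OF LA SA]]] sq])
    from filt_add[OF ideal_filt[OF this] filt_one]
    show ?thesis unfolding eqm_def eq by simp
  qed
  consider "k = i" | "k = i + 1" | "k \<noteq> i" "k \<noteq> i + 1" by blast
  then show ?thesis
  proof cases
    case 3
    then have "fS i * fL k - fL k * fS i \<in> I"
      using i k by (intro relation_in_ideal, unfold hecke_relations_def) blast
    then show ?thesis using 3 by (auto intro: eqm_ideal)
  qed (use 1 2 in auto)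
qed

text \<open>For exact equality the factor may have any degree, as the ideal absorbs it;
  \<open>eqm_mult_left\<close> at level 0 would admit only factors of degree 0.\<close>

lemma eqm_0_mult_left: "eqm 0 p q \<Longrightarrow> r \<in> A \<Longrightarrow> eqm 0 (r * p) (r * q)"
  using ideal_mult_left[of "p - q" r] by (simp add: eqm_def filt_0 right_diff_distrib)

lemma eqm_0_mult_right: "eqm 0 p q \<Longrightarrow> r \<in> A \<Longrightarrow> eqm 0 (p * r) (q * r)"
  using ideal_mult_right[of "p - q" r] by (simp add: eqm_def filt_0 left_diff_distrib)

lemma fL_lword_commute:
  assumes "k \<in> {1..n}" "set ks \<subseteq> {1..n}"
  shows "eqm 0 (fL k * lword ks) (lword ks * fL k)"
  using assms(2)
proof (induction ks)
  case (Cons j ks)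
  have "eqm 0 (fL k * fL j * lword ks) (fL j * fL k * lword ks)"
    using Cons.prems assms(1) by (intro eqm_0_mult_right fL_commute lword_A) auto
  also have "eqm 0 (fL j * fL k * lword ks) (fL j * (lword ks * fL k))"
    using Cons by (simp only: mult.assoc) (intro eqm_0_mult_left A_closed, auto)
  finally show ?case by (simp add: mult.assoc)
qed simp

lemma lword_mset_cong:
  assumes "mset ks = mset ks'" "set ks \<subseteq> {1..n}"
  shows "eqm 0 (lword ks) (lword ks')"
  using assms
proof (induction ks arbitrary: ks')
  case (Cons k ks)
  then have "k \<in> set ks'" by (metis list.set_intros(1) set_mset_mset)
  then obtain a b where ks': "ks' = a @ k # b" by (meson split_list)
  have sets: "set ks' \<subseteq> {1..n}" using Cons.prems by (metis set_mset_mset)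
  have k: "k \<in> {1..n}" using Cons.prems by simp
  have "eqm 0 (fL k * lword ks) (fL k * lword (a @ b))"
    using Cons ks' by (intro eqm_0_mult_left Cons.IH A_closed) auto
  also have "fL k * lword (a @ b) = fL k * lword a * lword b" by (simp add: mult.assoc)
  also have "eqm 0 \<dots> (lword a * fL k * lword b)"
    using sets k ks' by (intro eqm_0_mult_right fL_lword_commute lword_A) auto
  finally show ?case by (simp add: ks' mult.assoc)
qed simp

text \<open>Iterates \<open>fS_fL\<close>. Each exchange leaves an error that has lost one
  \<open>L\<close>, and the remaining letters bring its degree to less than
  \<open>length ks\<close>.\<close>

lemma fS_lword:
  assumes i: "1 \<le> i" "i < n" and ks: "set ks \<subseteq> {1..n}"
  shows "eqm (length ks) (fS i * lword ks) (lword (map (Transposition.transpose i (i + 1)) ks) * fS i)"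
  using ks
proof (induction ks)
  case (Cons k ks)
  let ?\<sigma> = "Transposition.transpose i (i + 1)"
  have k: "k \<in> {1..n}" "?\<sigma> k \<in> {1..n}" and ks: "set ks \<subseteq> {1..n}"
    using Cons.prems i by (auto simp: transpose_def)
  have "eqm (Suc (length ks)) (fS i * fL k * lword ks) (fL (?\<sigma> k) * fS i * lword ks)"
    using eqm_mult_right[OF fS_fL[OF i k(1)] filt_lword[OF ks]] by simp
  also have "eqm (Suc (length ks)) (fL (?\<sigma> k) * fS i * lword ks) (fL (?\<sigma> k) * (lword (map ?\<sigma> ks) * fS i))"
    using eqm_mult_left[OF Cons.IH[OF ks] filt_fL[of "?\<sigma> k"]] k by (simp add: mult.assoc)
  finally show ?case by (simp add: mult.assoc)
qed simp

text \<open>Existence of some permutation of the indices suffices: in \<open>T_top\<close> all the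
  \<open>L_k\<close> occur equally often, and this is preserved by any permutation.\<close>

lemma sword_lword:
  assumes "set is \<subseteq> {1..<n}" "set ks \<subseteq> {1..n}"
  shows "\<exists>w. w permutes {1..n} \<and> eqm (length ks) (sword is * lword ks) (lword (map w ks) * sword is)"
  using assms(1)
proof (induction "is")
  case Nil
  then show ?case by (intro exI[of _ id]) (simp add: permutes_def)
next
  case (Cons i js)
  let ?\<sigma> = "Transposition.transpose i (i + 1)"
  obtain w where w: "w permutes {1..n}" "eqm (length ks) (sword js * lword ks) (lword (map w ks) * sword js)"
    using Cons by auto
  have i: "1 \<le> i" "i < n" and js: "set js \<subseteq> {1..<n}" using Cons.prems by auto
  have wks: "set (map w ks) \<subseteq> {1..n}" using assms(2) permutes_in_image[OF w(1)] by auto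
  have "eqm (length ks) (fS i * (sword js * lword ks)) (fS i * lword (map w ks) * sword js)"
    using eqm_mult_left[OF w(2) filt_fS[OF i]] by (simp add: mult.assoc)
  also have "eqm (length ks) (fS i * lword (map w ks) * sword js) (lword (map (?\<sigma> \<circ> w) ks) * fS i * sword js)"
    using eqm_mult_right[OF fS_lword[OF i wks] filt_sword[OF js]] by simp
  finally have "eqm (length ks) (sword (i # js) * lword ks) (lword (map (?\<sigma> \<circ> w) ks) * sword (i # js))"
    by (simp only: sword_simps mult.assoc)
  moreover have "?\<sigma> \<circ> w permutes {1..n}"
    using i by (intro permutes_compose[OF w(1)] permutes_swap_id) auto
  ultimately show ?case by blast
qed

text \<open>The leading term is the product of the \<open>L_k\<close>. Factors are indexed by pairs
  \<open>(k, s)\<close> so that both the cyclotomic relation and \<open>u_elt\<close> are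
  instances.\<close>

lemma shifted_product_eqm_lword:
  assumes "fst ` set ps \<subseteq> {1..n}"
  shows "eqm (length ps) (prod_list (map (\<lambda>(k, s). fL k - fscal (u s)) ps)) (lword (map fst ps))"
  using assms
proof (induction ps)
  case (Cons p ps)
  obtain k s where p: "p = (k, s)" by (cases p)
  have k: "1 \<le> k" "k \<le> n" and ps: "fst ` set ps \<subseteq> {1..n}" using Cons.prems p by auto
  let ?P = "prod_list (map (\<lambda>(k, s). fL k - fscal (u s)) ps)"
  have ks: "lword (map fst ps) \<in> filt (Suc (length ps))"
    using filt_lword[of "map fst ps"] ps by simp
  have "eqm (Suc (length ps)) ((fL k - fscal (u s)) * ?P) ((fL k - fscal (u s)) * lword (map fst ps))"
    using filt_diff[OF filt_fL[OF k] filt_mono[OF filt_fscal]]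
    by (intro eqm_mult_left[OF Cons.IH[OF ps]]) auto
  also have "eqm (Suc (length ps)) ((fL k - fscal (u s)) * lword (map fst ps)) (fL k * lword (map fst ps))"
    using filt_fscal filt_minus by (intro eqm_mult_right[OF _ ks, of 1]) (auto simp: eqm_def)
  finally show ?case by (simp add: p)
qed simp

lemma lword_replicate_filt:
  assumes "k \<in> {1..n}"
  shows "lword (replicate l k) \<in> filt l"
proof -
  have "1 \<le> k" "k \<le> n" using assms by auto
  then show ?thesis
  proof (induction k rule: nat_induct_at_least)
    case base
    let ?ps = "map (\<lambda>s. (1::nat, s)) [1..<Suc l]"
    have "prod_list (map (\<lambda>k. fL 1 - fscal (u k)) [1..<Suc l]) \<in> I"
      by (intro relation_in_ideal) (simp add: hecke_relations_def)
    then have "prod_list (map (\<lambda>(k, s). fL k - fscal (u s)) ?ps) \<in> filt l"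
      by (intro ideal_filt) (simp only: map_map o_def case_prod_conv)
    moreover have "fst ` set ?ps \<subseteq> {1..n}"
      using n_pos by auto
    from shifted_product_eqm_lword[OF this]
    have "eqm l (prod_list (map (\<lambda>(k, s). fL k - fscal (u s)) ?ps)) (lword (map fst ?ps))"
      by (simp only: length_map length_upt diff_Suc_1)
    moreover have "map fst ?ps = replicate l 1"
      by (simp add: map_replicate_const o_def del: upt_Suc)
    ultimately show ?case using eqm_filt eqm_sym by metis
  next
    case (Suc k)
    have k: "1 \<le> k" "k < n" and IH: "lword (replicate l k) \<in> filt l" using Suc by auto
    have S: "fS k \<in> filt (Suc 0)" "fS k \<in> A" using k by (auto intro: filt_fS A_closed)
    have "set (replicate l k) \<subseteq> {1..n}" using k by auto
    from fS_lword[OF k this]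
    have "eqm l (fS k * lword (replicate l k)) (lword (replicate l (Suc k)) * fS k)" by simp
    then have "lword (replicate l (Suc k)) * fS k \<in> filt l"
      using eqm_filt[OF eqm_sym] filt_mult[OF S(1) IH, of l] by simp
    \<comment> \<open>The trailing \<open>s_k\<close> is removed by multiplying with it once more,
      since its square is 1 and degree-0 factors preserve \<open>filt l\<close>.\<close>
    then have "lword (replicate l (Suc k)) * fS k * fS k \<in> filt l"
      using filt_mult[OF _ S(1)] by simp
    moreover have "eqm l (lword (replicate l (Suc k)) * (fS k * fS k)) (lword (replicate l (Suc k)) * 1)"
      using Suc by (intro eqm_mono[OF eqm_0_mult_left[OF fS_square[OF k]]] lword_A) auto
    ultimately show ?case using eqm_filt[OF eqm_sym] by (simp add: mult.assoc)
  qed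
qed

text \<open>Read the word from the right and keep all \<open>L_k\<close> in front: a new
  \<open>L_k\<close> is prepended, a new \<open>s_i\<close> is pushed through and permutes the
  indices. Exponents may still exceed \<open>l - 1\<close> here.\<close>

lemma straighten:
  assumes "set v \<subseteq> gens n"
  shows "\<exists>ks is. set ks \<subseteq> {1..n} \<and> set is \<subseteq> {1..<n} \<and> length ks = ldeg v
    \<and> eqm (ldeg v) (prod_list (map fgen v)) (lword ks * sword is)"
  using assms
proof (induction v)
  case Nil
  then show ?case by (intro exI[of _ "[]"]) simp
next
  case (Cons g v)
  then obtain ks "is" where IH: "set ks \<subseteq> {1..n}" "set is \<subseteq> {1..<n}" "length ks = ldeg v"
    "eqm (ldeg v) (prod_list (map fgen v)) (lword ks * sword is)" by auto
  show ?case
  proof (cases g)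
    case (GenL k)
    then have k: "1 \<le> k" "k \<le> n" using Cons.prems by (auto simp: gens_def)
    have "eqm (Suc (ldeg v)) (fL k * prod_list (map fgen v)) (fL k * (lword ks * sword is))"
      using eqm_mult_left[OF IH(4) filt_fL[OF k]] by simp
    then show ?thesis
      using IH k GenL by (intro exI[of _ "k # ks"] exI[of _ "is"]) (auto simp: mult.assoc)
  next
    case (GenS i)
    then have i: "1 \<le> i" "i < n" using Cons.prems by (auto simp: gens_def)
    let ?\<sigma> = "Transposition.transpose i (i + 1)"
    have "eqm (ldeg v) (fS i * prod_list (map fgen v)) (fS i * (lword ks * sword is))"
      using eqm_mult_left[OF IH(4) filt_fS[OF i]] by simp
    also have "eqm (ldeg v) (fS i * (lword ks * sword is)) (lword (map ?\<sigma> ks) * fS i * sword is)"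
      using eqm_mult_right[OF fS_lword[OF i IH(1)] filt_sword[OF IH(2)]] IH(3) by (simp add: mult.assoc)
    finally have "eqm (ldeg (g # v)) (prod_list (map fgen (g # v))) (lword (map ?\<sigma> ks) * sword (i # is))"
      using GenS by (simp add: mult.assoc)
    moreover have "set (map ?\<sigma> ks) \<subseteq> {1..n}"
      using IH(1) i permutes_in_image[OF permutes_swap_id[of i "{1..n}" "i + 1"]] by auto
    moreover have "set (i # is) \<subseteq> {1..<n}" "length (map ?\<sigma> ks) = ldeg (g # v)"
      using IH i GenS by auto
    ultimately show ?thesis by blast
  qed
qed

end

section \<open>Values of the form\<close>

lemma prod_list_map_concat:
  "prod_list (map f (concat xss)) = prod_list (map (\<lambda>xs. prod_list (map f xs)) xss)"
  by (induction xss) simp_all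

lemma count_list_concat_replicate:
  "distinct xs \<Longrightarrow> count_list (concat (map (\<lambda>i. replicate (c i) i) xs)) x = (if x \<in> set xs then c x else 0)"
proof (induction xs)
  case (Cons i xs)
  have "count_list (replicate m i) x = (if x = i then m else 0)" for m
    by (induction m) auto
  then show ?case using Cons by auto
qed simp

lemma free_alg_eq_sum:
  fixes q :: "'r::comm_ring_1 free_alg"
  shows "q = (\<Sum>w\<in>Poly_Mapping.keys q. fscal (Poly_Mapping.lookup q w) * prod_list (map fgen (letters w)))"
proof -
  have single: "Poly_Mapping.single w a = fscal a * prod_list (map fgen (letters w))" for w and a :: 'r
    by (cases w) (simp add: single_fword)
  have "q = (\<Sum>w\<in>Poly_Mapping.keys q. Poly_Mapping.single w (Poly_Mapping.lookup q w))"
    by (rule poly_mapping_eqI)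
      (simp add: lookup_sum lookup_single when_def in_keys_iff)
  also have "\<dots> = (\<Sum>w\<in>Poly_Mapping.keys q. fscal (Poly_Mapping.lookup q w) * prod_list (map fgen (letters w)))"
    by (intro sum.cong refl) (rule single)
  finally show ?thesis .
qed

locale BK_form = degenerate_hecke l n u for l n :: nat and u :: "nat \<Rightarrow> 'r::comm_ring_1" +
  fixes \<tau> :: "'r free_alg set \<Rightarrow> 'r"
  assumes l_pos: "l \<ge> 1" and BK: "is_BK_form l n u \<tau>"
begin

section \<open>The form pulled back to the free algebra\<close>

definition T :: "'r free_alg \<Rightarrow> 'r" where
  "T p = \<tau> (hclass l n u p)"

lemma T_add: "p \<in> A \<Longrightarrow> q \<in> A \<Longrightarrow> T (p + q) = T p + T q"
  using BK hclass_carrier[of p] hclass_carrier[of q] hclass_add[of p q]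
  unfolding is_BK_form_def T_def by metis

lemma T_fscal: "p \<in> A \<Longrightarrow> T (fscal a * p) = a * T p"
  using BK hclass_carrier[of p] hclass_mult[OF A_closed(7), of p a]
  unfolding is_BK_form_def T_def hscal_def by metis

lemma T_0: "T 0 = 0"
  using T_fscal[of 0 0] by (simp add: A_closed)

lemma T_sum: "(\<And>x. x \<in> X \<Longrightarrow> f x \<in> A) \<Longrightarrow> T (sum f X) = (\<Sum>x\<in>X. T (f x))"
  by (induction X rule: infinite_finite_induct) (auto simp: T_0 T_add sum_A)

lemma T_cong: "eqm 0 p q \<Longrightarrow> T p = T q"
  unfolding T_def by (intro arg_cong[of _ _ \<tau>] hclass_cong) (simp add: eqm_def filt_0)

text \<open>The \<open>L_k\<close> commute exactly, and words for the same permutation agree in the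
  algebra, so the product equals a basis element on the nose. Exponents are read off as
  multiplicities, so the letters of \<open>ks\<close> may come in any order.\<close>

lemma T_basis:
  assumes ks: "set ks \<subseteq> {1..n}" "\<And>i. i \<in> {1..n} \<Longrightarrow> count_list ks i \<le> l - 1" and "is": "set is \<subseteq> {1..<n}"
  shows "T (lword ks * sword is)
    = (if word_perm is = id \<and> (\<forall>i\<in>{1..n}. count_list ks i = l - 1) then 1 else 0)"
proof -
  let ?c = "count_list ks" and ?w = "word_perm is"
  define ks' where "ks' = concat (map (\<lambda>i. replicate (?c i) i) [1..<Suc n])"
  have w: "?w permutes {1..n}" by (rule word_perm_permutes[OF "is"])
  have "mset ks = mset ks'"
    using ks(1) count_list_0_iff[of ks] unfolding ks'_def
    by (intro multiset_eqI) (auto simp: count_mset count_list_concat_replicate simp del: upt_Suc)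
  then have "eqm 0 (lword ks) (lword ks')" and ks': "set ks' \<subseteq> {1..n}"
    using lword_mset_cong ks(1) mset_eq_setD by blast+
  then have "eqm 0 (lword ks * sword is) (lword ks' * sword is)"
    using "is" by (intro eqm_0_mult_right sword_A)
  also have "eqm 0 \<dots> (lword ks' * sword (pword n ?w))"
    using pword[OF w] "is" ks' by (intro eqm_0_mult_left eqm_sword lword_A) auto
  finally have "T (lword ks * sword is) = T (lword ks' * sword (pword n ?w))" by (rule T_cong)
  also have "\<dots> = \<tau> (hbasis l n u ?c ?w)"
  proof -
    have L: "fL i \<in> A" if "i \<in> set [1..<Suc n]" for i using that by (auto intro!: A_closed simp del: upt_Suc)
    have "hprod l n u (map (\<lambda>i. hL l n u i [^]\<^bsub>H\<^esub> ?c i) [1..<Suc n])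
        = hprod l n u (map (\<lambda>i. hclass l n u (fL i ^ ?c i)) [1..<Suc n])"
      unfolding hL_def
      by (intro arg_cong[of _ _ "hprod l n u"] map_cong refl conjunct1[OF hclass_pow[OF L]])
    also have "\<dots> = hclass l n u (lword ks')"
      unfolding ks'_def lword_concat_replicate by (intro hclass_prod_list conjunct2[OF hclass_pow[OF L]])
    finally show ?thesis
      using pword(1)[OF w] ks' unfolding hbasis_def hperm_eq[OF w] T_def
      by (simp only: hclass_mult[OF lword_A sword_A])
  qed
  also have "\<dots> = (if ?w = id \<and> (\<forall>i\<in>{1..n}. ?c i = l - 1) then 1 else 0)"
    using BK w ks(2) unfolding is_BK_form_def by auto
  finally show ?thesis .
qed

lemma T_eqm:
  assumes "eqm d p q" "q \<in> A" "\<And>r. r \<in> filt d \<Longrightarrow> T r = 0"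
  shows "T p = T q"
proof -
  have "p - q \<in> filt d" using assms by (simp add: eqm_def)
  then have "T (p - q + q) = 0 + T q" using assms by (simp only: T_add filt_A)
  then show ?thesis by simp
qed

text \<open>Induction on the degree bound. A word of degree at most \<open>d\<close> is straightened
  at the cost of terms of smaller degree, on which the induction hypothesis gives 0. The result is
  either a basis element other than the top one, or contains some \<open>L_k\<close> at least
  \<open>l\<close> times and drops in degree.\<close>

lemma T_filt: "d \<le> n * (l - 1) \<Longrightarrow> p \<in> filt d \<Longrightarrow> T p = 0"
proof (induction d arbitrary: p)
  case 0
  then have "eqm 0 p 0" by (simp add: eqm_def)
  then show ?case using T_cong T_0 by metis
next
  case (Suc d)
  obtain q where q: "q \<in> A" "\<And>w. w \<in> Poly_Mapping.keys q \<Longrightarrow> ldeg (letters w) < Suc d" "p - q \<in> I"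
    using Suc.prems by (auto simp: filt_def)
  have IH: "T r = 0" if "r \<in> filt e" "e \<le> d" for r e
    using Suc.IH filt_mono[OF that] Suc.prems by simp
  have fgen_A: "fgen g \<in> A" if "g \<in> gens n" for g
    using that by (auto simp: gens_def intro!: A_closed)
  have mono: "prod_list (map fgen v) \<in> A \<and> T (prod_list (map fgen v)) = 0"
    if v: "set v \<subseteq> gens n" "ldeg v \<le> d" for v
  proof
    show A: "prod_list (map fgen v) \<in> A"
      using v(1) fgen_A by (intro prod_list_A) auto
    obtain ks "is" where ks: "set ks \<subseteq> {1..n}" "set is \<subseteq> {1..<n}" "length ks = ldeg v"
      "eqm (ldeg v) (prod_list (map fgen v)) (lword ks * sword is)"
      using straighten[OF v(1)] by blast
    have "T (prod_list (map fgen v)) = T (lword ks * sword is)"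
      using ks v by (intro T_eqm[OF ks(4)] IH[of _ "ldeg v"] A_closed lword_A sword_A)
    also have "\<dots> = 0"
    proof (cases "\<forall>i\<in>{1..n}. count_list ks i \<le> l - 1")
      case True
      have "\<not> (\<forall>i\<in>{1..n}. count_list ks i = l - 1)"
      proof
        assume "\<forall>i\<in>{1..n}. count_list ks i = l - 1"
        \<comment> \<open>The top basis monomial would have degree \<open>n * (l - 1)\<close>, while
          the degree of \<open>v\<close> is at most \<open>d\<close>.\<close>
        then have "length ks = n * (l - 1)"
          using sum_count_set[OF ks(1)] by simp
        then show False using ks(3) v Suc.prems by simp
      qed
      then show ?thesis using T_basis[OF ks(1) _ ks(2)] True by simp
    next
      case False
      then obtain k where k: "k \<in> {1..n}" "l \<le> count_list ks k" by auto
      then have "replicate_mset l k \<subseteq># mset ks"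
        by (simp add: count_mset flip: count_le_replicate_mset_subset_eq)
      then obtain M where "mset ks = replicate_mset l k + M" by (metis subset_mset.add_diff_inverse)
      moreover obtain js where "M = mset js" using ex_mset by metis
      ultimately have js: "mset ks = mset (replicate l k @ js)" by simp
      then have "set js \<subseteq> {1..n}" and len: "length ks = l + length js"
        using ks(1) mset_eq_setD[OF js] mset_eq_length[OF js] by auto
      then have "lword (replicate l k @ js) \<in> filt (length ks)"
        using filt_mult[OF lword_replicate_filt[OF k(1)] filt_lword] by simp
      then have "lword ks \<in> filt (length ks)"
        using eqm_filt[OF eqm_mono[OF lword_mset_cong[OF js ks(1)]]] by simp
      then have "lword ks * sword is \<in> filt (length ks)"
        by (rule filt_mult[OF _ filt_sword[OF ks(2)]]) simp
      then show ?thesis using IH ks(3) v(2) by simp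
    qed
    finally show "T (prod_list (map fgen v)) = 0" .
  qed
  have word: "prod_list (map fgen (letters w)) \<in> A \<and> T (prod_list (map fgen (letters w))) = 0"
    if "w \<in> Poly_Mapping.keys q" for w
    using q(1,2) that by (intro mono) (auto simp: free_algebra_simps(1) less_Suc_eq_le)
  have "T p = T q" using q(3) by (intro T_cong) (simp add: eqm_ideal)
  also have "\<dots> = (\<Sum>w\<in>Poly_Mapping.keys q. T (fscal (Poly_Mapping.lookup q w) * prod_list (map fgen (letters w))))"
    by (subst free_alg_eq_sum, rule T_sum) (simp add: word A_closed)
  also have "\<dots> = 0" using word by (simp add: T_fscal)
  finally show ?case .
qed

text \<open>Permuting the indices of a monomial with all exponents \<open>l - 1\<close> does not
  change its multiplicities. The errors made in moving \<open>sword xs\<close> to the right have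
  degree below \<open>n * (l - 1)\<close>, so the form kills them and one basis element
  remains.\<close>

lemma T_top:
  assumes "set ks \<subseteq> {1..n}" "\<And>i. i \<in> {1..n} \<Longrightarrow> count_list ks i = l - 1"
    and "set xs \<subseteq> {1..<n}" "set ys \<subseteq> {1..<n}"
  shows "T (sword xs * lword ks * sword ys) = (if word_perm (xs @ ys) = id then 1 else 0)"
proof -
  have len: "length ks = n * (l - 1)" using sum_count_set[OF assms(1)] assms(2) by simp
  obtain w where w: "w permutes {1..n}" "eqm (length ks) (sword xs * lword ks) (lword (map w ks) * sword xs)"
    using sword_lword[OF assms(3,1)] by blast
  have wks: "set (map w ks) \<subseteq> {1..n}" using assms(1) permutes_in_image[OF w(1)] by auto
  have cnt: "count_list (map w ks) i = l - 1" if "i \<in> {1..n}" for i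
  proof -
    have "i \<in> w ` {1..n}" using that permutes_image[OF w(1)] by simp
    then obtain j where j: "i = w j" "j \<in> {1..n}" by blast
    show ?thesis unfolding j(1) count_list_map_conv[OF permutes_inj[OF w(1)]] by (rule assms(2)[OF j(2)])
  qed
  have "eqm (length ks) (sword xs * lword ks * sword ys) (lword (map w ks) * sword (xs @ ys))"
    using eqm_mult_right[OF w(2) filt_sword[OF assms(4)]] by (simp add: mult.assoc)
  then have "T (sword xs * lword ks * sword ys) = T (lword (map w ks) * sword (xs @ ys))"
  proof (rule T_eqm)
    show "lword (map w ks) * sword (xs @ ys) \<in> A"
      using assms(3,4) by (intro A_closed lword_A[OF wks] sword_A) simp
    show "T r = 0" if "r \<in> filt (length ks)" for r using that len by (intro T_filt[of "length ks"]) simp_all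
  qed
  also have "\<dots> = (if word_perm (xs @ ys) = id then 1 else 0)"
    by (subst T_basis[OF wks]) (use cnt assms(3,4) in auto)
  finally show ?thesis .
qed

text \<open>The degree of \<open>U\<close> is the sum of the \<open>a s\<close> over
  \<open>s\<close> from 2 to \<open>l\<close>. It reaches \<open>n * (l - 1)\<close> only when every
  \<open>a s\<close> is \<open>n\<close>, and then \<open>T_top\<close> applies to the leading term;
  otherwise \<open>T_filt\<close> gives 0.\<close>

lemma T_sandwich:
  assumes a: "\<And>s. a s \<le> n" and xs: "set xs \<subseteq> {1..<n}" and ys: "set ys \<subseteq> {1..<n}"
  defines "U \<equiv> prod_list (map (\<lambda>s. prod_list (map (\<lambda>k. fL k - fscal (u s)) [1..<Suc (a s)])) [2..<Suc l])"
  shows "U \<in> A"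
    and "T (sword xs * U * sword ys)
      = (if (\<forall>s\<in>{2..l}. a s = n) \<and> word_perm (xs @ ys) = id then 1 else 0)"
proof -
  define ps where "ps = concat (map (\<lambda>s. map (\<lambda>k. (k, s)) [1..<Suc (a s)]) [2..<Suc l])"
  have U: "U = prod_list (map (\<lambda>(k, s). fL k - fscal (u s)) ps)"
    unfolding U_def ps_def prod_list_map_concat by (simp add: o_def del: upt_Suc)
  have fst: "map fst ps = concat (map (\<lambda>s. [1..<Suc (a s)]) [2..<Suc l])"
    unfolding ps_def map_concat by (simp add: o_def del: upt_Suc)
  have ps: "fst ` set ps \<subseteq> {1..n}"
  proof
    fix k assume "k \<in> fst ` set ps"
    then obtain s where "k \<in> set [1..<Suc (a s)]" by (auto simp: ps_def simp del: upt_Suc)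
    then show "k \<in> {1..n}" using a[of s] by (auto simp del: upt_Suc)
  qed
  have "fL k - fscal (u s) \<in> A" if "(k, s) \<in> set ps" for k s
  proof -
    have "k \<in> {1..n}" using subsetD[OF ps imageI[OF that]] by simp
    then show ?thesis by (intro A_closed) auto
  qed
  then show UA: "U \<in> A" unfolding U by (intro prod_list_A) auto
  have len: "length ps = (\<Sum>s\<in>{2..l}. a s)"
    by (simp add: ps_def length_concat o_def sum_list_distinct_conv_sum_set atLeastLessThanSuc_atLeastAtMost del: upt_Suc)
  have Ueq: "eqm (length ps) U (lword (map fst ps))"
    unfolding U by (rule shifted_product_eqm_lword[OF ps])
  have lw: "lword (map fst ps) \<in> filt (Suc (length ps))"
    using filt_lword[of "map fst ps"] ps by simp
  show "T (sword xs * U * sword ys)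
      = (if (\<forall>s\<in>{2..l}. a s = n) \<and> word_perm (xs @ ys) = id then 1 else 0)"
  proof (cases "\<forall>s\<in>{2..l}. a s = n")
    case True
    have "count_list (map fst ps) i = l - 1" if "i \<in> {1..n}" for i
    proof -
      have "count_list [1..<Suc n] i = 1"
        using that by (simp add: count_list_eq_length_filter distinct_length_filter del: upt_Suc)
      \<comment> \<open>Each index from 1 to \<open>n\<close> is listed once for every
        \<open>s\<close> from 2 to \<open>l\<close>, hence \<open>l - 1\<close> times.\<close>
      moreover have "map fst ps = concat (map (\<lambda>s. [1..<Suc n]) [2..<Suc l])"
        unfolding fst using True by (intro arg_cong[of _ _ concat] map_cong) auto
      moreover have "count_list (concat (map (\<lambda>s. xs) zs)) i = length zs * count_list xs i" for xs and zs :: "nat list"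
        by (induction zs) auto
      ultimately show ?thesis by (simp del: upt_Suc)
    qed
    then have "T (sword xs * lword (map fst ps) * sword ys) = (if word_perm (xs @ ys) = id then 1 else 0)"
      using ps xs ys by (intro T_top) auto
    moreover have "T (sword xs * U * sword ys) = T (sword xs * lword (map fst ps) * sword ys)"
    proof (rule T_eqm)
      show "eqm (length ps) (sword xs * U * sword ys) (sword xs * lword (map fst ps) * sword ys)"
        by (intro eqm_mult_right[OF eqm_mult_left[OF Ueq filt_sword[OF xs]] filt_sword[OF ys]]) auto
      show "T r = 0" if "r \<in> filt (length ps)" for r
        using that True by (intro T_filt[of "length ps"]) (simp_all add: len)
      show "sword xs * lword (map fst ps) * sword ys \<in> A"
        using ps by (intro A_closed lword_A sword_A xs ys) simp
    qed
    ultimately show ?thesis using True by simp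
  next
    case False
    have "length ps < (\<Sum>s\<in>{2..l}. n)"
      unfolding len using False a by (intro sum_strict_mono_ex1) (auto intro: le_neq_trans)
    \<comment> \<open>The strict inequality leaves room for the \<open>Suc\<close>: degree at most
      \<open>length ps\<close> only places \<open>U\<close> in
      \<open>filt (Suc (length ps))\<close>.\<close>
    then have "Suc (length ps) \<le> n * (l - 1)" using l_pos by (simp add: mult.commute)
    moreover have "U \<in> filt (Suc (length ps))"
      using eqm_filt[OF eqm_mono[OF Ueq] lw] by simp
    then have "sword xs * U * sword ys \<in> filt (Suc (length ps))"
      by (intro filt_mult[OF filt_mult[OF filt_sword[OF xs]] filt_sword[OF ys]]) auto
    ultimately show ?thesis using False T_filt by auto
  qed
qed

end

section \<open>Standard tableaux\<close>

text \<open>Both functions are injective, so the inclusion of images is an equality by cardinality,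
  and a finite set has only one increasing enumeration. It is applied to rows of standard
  tableaux.\<close>

lemma strict_mono_on_eqI:
  fixes f g :: "nat \<Rightarrow> 'a::linorder"
  assumes "\<And>i j. a \<le> i \<Longrightarrow> i < j \<Longrightarrow> j \<le> b \<Longrightarrow> f i < f j"
    and "\<And>i j. a \<le> i \<Longrightarrow> i < j \<Longrightarrow> j \<le> b \<Longrightarrow> g i < g j"
    and "f ` {a..b} \<subseteq> g ` {a..b}" and "i \<in> {a..b}"
  shows "f i = g i"
proof -
  have inj: "inj_on f {a..b}" "inj_on g {a..b}"
    by (rule linorder_inj_onI; use assms in force)+
  have "f ` {a..b} = g ` {a..b}"
    using assms(3) by (intro card_subset_eq) (auto simp: card_image inj)
  then have "map f [a..<Suc b] = map g [a..<Suc b]"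
    using inj assms(1,2)
    by (intro sorted_distinct_set_unique)
      (auto simp: distinct_map sorted_wrt_map sorted_wrt_upt atLeastLessThanSuc_atLeastAtMost
        simp del: upt_Suc intro!: sorted_wrt_mono_rel[OF _ sorted_wrt_upt] less_imp_le)
  then show ?thesis using assms(4) by (auto simp del: upt_Suc)
qed

section \<open>Row and component intervals of the initial tableau\<close>

lemma sum_list_take_mono: "j \<le> k \<Longrightarrow> sum_list (take j xs) \<le> sum_list (take k (xs :: nat list))"
  by (metis le_add1 min.absorb1 sum_list.append take_add take_take le_iff_add)

lemma sum_list_take_Suc: "j < length xs \<Longrightarrow> sum_list (take (Suc j) xs) = sum_list (take j xs) + (xs ! j :: nat)"
  by (simp add: take_Suc_conv_app_nth)

lemma acharge_le: "lam \<in> multipartitions l n \<Longrightarrow> acharge lam s \<le> n"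
  using sum_list_take_mono[of "s - 1" "length (map sum_list lam)" "map sum_list lam"]
  by (cases "s - 1 \<le> length lam") (auto simp: acharge_def multipartitions_def take_map)

lemma acharge_mono: "s \<le> t \<Longrightarrow> acharge lam s \<le> acharge lam t"
  using sum_list_take_mono[of "s - 1" "t - 1" "map sum_list lam"] by (simp add: acharge_def take_map)

text \<open>Row \<open>r\<close> of a component fills the interval above \<open>b (r - 1)\<close> up
  to \<open>b r\<close>, and component \<open>k\<close> lies above \<open>acharge lam k\<close> up
  to \<open>acharge lam (Suc k)\<close>. Disjointness of these intervals gives injectivity
  below.\<close>

lemma init_tableau_bounds:
  assumes "(r, c, k) \<in> diagram lam"
  defines "b \<equiv> \<lambda>r. acharge lam k + sum_list (take r (lam ! (k - 1)))"
  shows "init_tableau lam (r, c, k) = b (r - 1) + c" "b (r - 1) < init_tableau lam (r, c, k)"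
    "init_tableau lam (r, c, k) \<le> b r"
    "acharge lam k < init_tableau lam (r, c, k)" "init_tableau lam (r, c, k) \<le> acharge lam (Suc k)"
proof -
  have d: "1 \<le> k" "k \<le> length lam" "1 \<le> r" "r \<le> length (lam ! (k - 1))" "1 \<le> c" "c \<le> lam ! (k - 1) ! (r - 1)"
    using assms(1) by (auto simp: diagram_def)
  show 1: "init_tableau lam (r, c, k) = b (r - 1) + c"
    using assms by (simp add: init_tableau_def)
  then show "b (r - 1) < init_tableau lam (r, c, k)" using d by simp
  show "acharge lam k < init_tableau lam (r, c, k)" using 1 d by (simp add: b_def)
  show 2: "init_tableau lam (r, c, k) \<le> b r"
    using 1 d sum_list_take_Suc[of "r - 1" "lam ! (k - 1)"] by (simp add: b_def)
  have "acharge lam (Suc k) = acharge lam k + sum_list (lam ! (k - 1))"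
    using d sum_list_take_Suc[of "k - 1" "map sum_list lam"] by (simp add: acharge_def take_map)
  moreover have "b r \<le> acharge lam k + sum_list (lam ! (k - 1))"
    using sum_list_take_mono[of r "length (lam ! (k - 1))" "lam ! (k - 1)"] d by (simp add: b_def)
  ultimately show "init_tableau lam (r, c, k) \<le> acharge lam (Suc k)" using 2 by simp
qed

lemma inj_on_init_tableau: "inj_on (init_tableau lam) (diagram lam)"
proof (rule inj_onI)
  fix x y assume x: "x \<in> diagram lam" and y: "y \<in> diagram lam" and eq: "init_tableau lam x = init_tableau lam y"
  obtain r c k where X: "x = (r, c, k)" by (cases x)
  obtain r' c' k' where Y: "y = (r', c', k')" by (cases y)
  note bx = init_tableau_bounds[OF x[unfolded X]] and by' = init_tableau_bounds[OF y[unfolded Y]]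
  have "\<not> k < k'"
  proof
    assume "k < k'"
    then have "acharge lam (Suc k) \<le> acharge lam k'" by (intro acharge_mono) simp
    then show False using bx(5) by'(4) eq X Y by simp
  qed
  moreover have "\<not> k' < k"
  proof
    assume "k' < k"
    then have "acharge lam (Suc k') \<le> acharge lam k" by (intro acharge_mono) simp
    then show False using bx(4) by'(5) eq X Y by simp
  qed
  ultimately have k: "k' = k" by simp
  have "\<not> r < r'"
  proof
    assume "r < r'"
    then have "sum_list (take r (lam ! (k - 1))) \<le> sum_list (take (r' - 1) (lam ! (k - 1)))"
      by (intro sum_list_take_mono) simp
    then show False using bx(3) by'(2) eq X Y k by simp
  qed
  moreover have "\<not> r' < r"
  proof
    assume "r' < r"
    then have "sum_list (take r' (lam ! (k - 1))) \<le> sum_list (take (r - 1) (lam ! (k - 1)))"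
      by (intro sum_list_take_mono) simp
    then show False using bx(2) by'(3) eq X Y k by simp
  qed
  ultimately have "r' = r" by simp
  then show "x = y" using bx(1) by'(1) eq X Y k by simp
qed

text \<open>The tableau \<open>t\<close> serves to count the diagram: it has \<open>n\<close> nodes,
  so an injection into \<open>{1..n}\<close> is onto.\<close>

lemma bij_betw_init_tableau:
  assumes "lam \<in> multipartitions l n" "t \<in> Std lam"
  shows "bij_betw (init_tableau lam) (diagram lam) {1..n}"
proof -
  have t: "bij_betw t (diagram lam) {1..n}"
    using assms by (auto simp: Std_def tableaux_def multipartitions_def)
  have "init_tableau lam x \<in> {1..n}" if "x \<in> diagram lam" for x
  proof -
    obtain r c k where "x = (r, c, k)" by (cases x)
    then show ?thesis
      using init_tableau_bounds[of r c k lam] that acharge_le[OF assms(1), of "Suc k"] by auto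
  qed
  then have "init_tableau lam ` diagram lam = {1..n}"
    using bij_betw_same_card[OF t] inj_on_init_tableau[of lam]
    by (intro card_subset_eq) (auto simp: card_image)
  then show ?thesis using inj_on_init_tableau by (simp add: bij_betw_def)
qed

lemma tab_perm:
  assumes "lam \<in> multipartitions l n" "t \<in> Std lam"
  shows "tab_perm lam t permutes {1..n}"
    and "x \<in> diagram lam \<Longrightarrow> t x = tab_perm lam t (init_tableau lam x)"
proof -
  let ?P = "\<lambda>w. w permutes {1..n} \<and> (\<forall>x\<in>diagram lam. t x = w (init_tableau lam x))"
  have n: "sum_list (map sum_list lam) = n" using assms by (simp add: multipartitions_def)
  have t: "bij_betw t (diagram lam) {1..n}"
    using assms by (auto simp: Std_def tableaux_def multipartitions_def)
  note i = bij_betw_init_tableau[OF assms]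
  let ?j = "the_inv_into (diagram lam) (init_tableau lam)"
  \<comment> \<open>The witness is \<open>t\<close> after the inverse of the initial tableau,
    extended by the identity so as to be a permutation of all of \<open>nat\<close>.\<close>
  let ?w = "\<lambda>m. if m \<in> {1..n} then t (?j m) else m"
  have "bij_betw (t \<circ> ?j) {1..n} {1..n}"
    by (rule bij_betw_trans[OF bij_betw_the_inv_into[OF i] t])
  then have "bij_betw ?w {1..n} {1..n}"
    by (rule bij_betw_cong[THEN iffD1, rotated]) simp
  then have "?w permutes {1..n}" by (rule bij_imp_permutes) auto
  moreover have "t x = ?w (init_tableau lam x)" if "x \<in> diagram lam" for x
    using that bij_betwE[OF i] by (simp add: the_inv_into_f_f[OF inj_on_init_tableau])
  ultimately have ex: "?P ?w" by blast
  have uniq: "v = w" if "?P v" "?P w" for v w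
  proof
    fix m show "v m = w m"
    proof (cases "m \<in> {1..n}")
      case True
      then obtain x where "x \<in> diagram lam" "m = init_tableau lam x"
        using i by (metis bij_betw_imp_surj_on imageE)
      then show ?thesis using that by metis
    qed (use that in \<open>auto simp: permutes_not_in\<close>)
  qed
  have "?P (tab_perm lam t)"
    unfolding tab_perm_def n by (rule theI[of ?P, OF ex]) (use uniq ex in blast)
  then show "tab_perm lam t permutes {1..n}" and "x \<in> diagram lam \<Longrightarrow> t x = tab_perm lam t (init_tableau lam x)"
    by blast+
qed

section \<open>Multipartitions concentrated in the first component\<close>

lemma tab_comp_eq_1_iff:
  assumes lam: "lam \<in> multipartitions l n" and t: "t \<in> Std lam"
  shows "(\<forall>i\<in>{1..n}. tab_comp lam t i = 1) \<longleftrightarrow> (\<forall>(r, c, k)\<in>diagram lam. k = 1)"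
proof -
  have "bij_betw t (diagram lam) {1..n}"
    using assms by (auto simp: Std_def tableaux_def multipartitions_def)
  then have *: "{1..n} = t ` diagram lam" "inj_on t (diagram lam)" by (auto simp: bij_betw_def)
  show ?thesis unfolding *(1)
    by (auto simp: tab_comp_def the_inv_into_f_f[OF *(2)] split: prod.splits)
qed

lemma single_component_nth:
  assumes lam: "lam \<in> multipartitions l n" and single: "\<forall>(r, c, k)\<in>diagram lam. k = 1"
    and j: "1 \<le> j" "j < l"
  shows "lam ! j = []"
proof (rule ccontr)
  assume ne: "lam ! j \<noteq> []"
  have len: "length lam = l" and "is_partition (lam ! j)"
    using lam j by (auto simp: multipartitions_def)
  then have "0 < lam ! j ! 0" using ne by (auto simp: is_partition_def)
  \<comment> \<open>List position \<open>j\<close> is component \<open>Suc j\<close>; a nonempty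
    partition there would contribute its corner node.\<close>
  then have "(1, 1, Suc j) \<in> diagram lam"
    using ne j len by (auto simp: diagram_def Suc_le_eq)
  then show False using single j by auto
qed

lemma single_component_iff_acharge:
  assumes lam: "lam \<in> multipartitions l n"
  shows "(\<forall>(r, c, k)\<in>diagram lam. k = 1) \<longleftrightarrow> (\<forall>s\<in>{2..l}. acharge lam s = n)"
proof
  have len: "length lam = l" using lam by (simp add: multipartitions_def)
  have split: "n = acharge lam s + sum_list (map sum_list (drop (s - 1) lam))" for s
  proof -
    have "n = sum_list (map sum_list (take (s - 1) lam @ drop (s - 1) lam))"
      using lam by (simp add: multipartitions_def)
    then show ?thesis by (simp only: acharge_def map_append sum_list.append)
  qed
  show "\<forall>s\<in>{2..l}. acharge lam s = n" if "\<forall>(r, c, k)\<in>diagram lam. k = 1"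
  proof
    fix s assume s: "s \<in> {2..l}"
    have "p = []" if "p \<in> set (drop (s - 1) lam)" for p
    proof -
      from that obtain i where "i < length lam - (s - 1)" "p = lam ! (s - 1 + i)"
        by (auto simp: in_set_conv_nth)
      then show ?thesis
        using single_component_nth[OF lam \<open>\<forall>(r, c, k)\<in>diagram lam. k = 1\<close>, of "s - 1 + i"] s len by auto
    qed
    then have "sum_list (map sum_list (drop (s - 1) lam)) = 0"
      by (fastforce simp: sum_list_eq_0_iff)
    then show "acharge lam s = n" using split[of s] by simp
  qed
  assume a: "\<forall>s\<in>{2..l}. acharge lam s = n"
  show "\<forall>(r, c, k)\<in>diagram lam. k = 1"
  proof (clarify, rule ccontr)
    fix r c k assume d: "(r, c, k) \<in> diagram lam" and "k \<noteq> 1"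
    then have "k \<in> {2..l}" using len by (auto simp: diagram_def)
    \<comment> \<open>A node in component \<open>k\<close> has an initial entry above
      \<open>acharge lam k\<close>, which is \<open>n\<close>, yet no entry exceeds
      \<open>n\<close>.\<close>
    then have "acharge lam k = n" using a by blast
    then show False
      using init_tableau_bounds(4,5)[OF d] acharge_le[OF lam, of "Suc k"] by simp
  qed
qed

text \<open>Since \<open>w\<close> preserves the rows of the initial tableau, each row of
  \<open>s\<close> has its entries in the same row of \<open>t\<close>. Rows of standard tableaux
  increase, so the rows coincide.\<close>

lemma Std_eq_if_young:
  assumes lam: "lam \<in> multipartitions l n" and st: "s \<in> Std lam" "t \<in> Std lam"
    and single: "\<forall>(r, c, k)\<in>diagram lam. k = 1"
    and w: "w \<in> young_subgroup (concat lam)" and eq: "tab_perm lam t \<circ> w = tab_perm lam s"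
  shows "s = t"
proof
  fix x
  have ext: "s \<in> extensional (diagram lam)" "t \<in> extensional (diagram lam)"
    using st by (auto simp: Std_def tableaux_def)
  show "s x = t x"
  proof (cases "x \<in> diagram lam")
    case True
    define p where "p = lam ! 0"
    obtain r c where x: "x = (r, c, 1)" using True single by (cases x) auto
    let ?m = "p ! (r - 1)" and ?b = "sum_list (take (r - 1) p)"
    have d: "0 < length lam" "1 \<le> r" "r \<le> length p" "1 \<le> c" "c \<le> ?m"
      using True x by (auto simp: diagram_def p_def)
    \<comment> \<open>All later components are empty, so the composition defining the Young subgroup
      is just the first partition.\<close>
    have "concat (drop 1 lam) = []"
      using single_component_nth[OF lam single] lam
      by (auto simp: in_set_conv_nth multipartitions_def)
    moreover have "lam = p # drop 1 lam" using d by (cases lam) (auto simp: p_def)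
    ultimately have cat: "concat lam = p" by (metis append_Nil2 concat.simps(2))
    have row: "w ` {?b <.. ?b + ?m} = {?b <.. ?b + ?m}"
      using w d sum_list_take_Suc[of "r - 1" p] unfolding young_subgroup_def cat
      by (auto dest!: spec[of _ "r - 1"])
    have node: "(r, j, 1) \<in> diagram lam \<longleftrightarrow> j \<in> {1..?m}" for j
      using d by (auto simp: diagram_def p_def Suc_le_eq)
    have init: "init_tableau lam (r, j, 1) = ?b + j" if "j \<in> {1..?m}" for j
      using init_tableau_bounds(1)[of r j 1 lam] node that by (simp add: acharge_def p_def)
    have "s (r, c, 1) = t (r, c, 1)"
    proof (rule strict_mono_on_eqI[where f = "\<lambda>c. s (r, c, 1)" and g = "\<lambda>c. t (r, c, 1)" and a = 1 and b = ?m])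
      show "s (r, i, 1) < s (r, j, 1)" "t (r, i, 1) < t (r, j, 1)" if "1 \<le> i" "i < j" "j \<le> ?m" for i j
        using st that node[of i] node[of j] by (auto simp: Std_def)
      show "(\<lambda>c. s (r, c, 1)) ` {1..?m} \<subseteq> (\<lambda>c. t (r, c, 1)) ` {1..?m}"
      proof clarify
        fix j assume j: "j \<in> {1..?m}"
        have "w (?b + j) \<in> w ` {?b <.. ?b + ?m}" using j by (intro imageI) auto
        then have "w (?b + j) \<in> {?b <.. ?b + ?m}" unfolding row .
        then obtain i where i: "i \<in> {1..?m}" "w (?b + j) = ?b + i"
          by (intro that[of "w (?b + j) - ?b"]) auto
        have "s (r, j, 1) = tab_perm lam t (w (?b + j))"
          using tab_perm(2)[OF lam st(1), of "(r, j, 1)"] node j init eq by (auto simp: fun_eq_iff)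
        also have "\<dots> = t (r, i, 1)"
          using tab_perm(2)[OF lam st(2), of "(r, i, 1)"] node i init by simp
        finally show "s (r, j, 1) \<in> (\<lambda>c. t (r, c, 1)) ` {1..?m}" using i by blast
      qed
    qed (use d in auto)
    then show ?thesis using x by simp
  qed (simp add: extensional_arb[OF ext(1)] extensional_arb[OF ext(2)])
qed

section \<open>The form on the Murphy basis\<close>

lemma young_subgroup_permutes:
  assumes "lam \<in> multipartitions l n" "w \<in> young_subgroup (concat lam)"
  shows "w permutes {1..n}"
proof -
  have "sum_list (concat lam) = sum_list (map sum_list lam)" by (induction lam) simp_all
  then show ?thesis using assms by (simp add: young_subgroup_def multipartitions_def)
qed

lemma finite_young_subgroup: "finite (young_subgroup \<mu>)"
  by (rule finite_subset[OF _ finite_permutations[of "{1..sum_list \<mu>}"]]) (auto simp: young_subgroup_def)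

context BK_form
begin

section \<open>Representatives of the factors of a Murphy element\<close>

lemma x_elt_eq:
  assumes lam: "lam \<in> multipartitions l n"
  shows "x_elt l n u lam = hclass l n u (\<Sum>w\<in>young_subgroup (concat lam). sword (pword n w))"
proof -
  interpret H: ring H by (rule hecke_ring[OF n_pos])
  have A: "sword (pword n w) \<in> A" if "w \<in> young_subgroup (concat lam)" for w
    by (rule sword_A[OF pword(1)[OF young_subgroup_permutes[OF lam that]]])
  have "x_elt l n u lam = (\<Oplus>\<^bsub>H\<^esub>w\<in>young_subgroup (concat lam). hclass l n u (sword (pword n w)))"
    unfolding x_elt_def
  proof (rule H.finsum_cong')
    show "(\<lambda>w. hclass l n u (sword (pword n w))) \<in> young_subgroup (concat lam) \<rightarrow> carrier H"
      using A by (intro Pi_I hclass_carrier)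
    show "hperm l n u w = hclass l n u (sword (pword n w))" if "w \<in> young_subgroup (concat lam)" for w
      by (rule hperm_eq[OF young_subgroup_permutes[OF lam that]])
  qed simp
  then show ?thesis using A by (simp only: hclass_sum[OF finite_young_subgroup])
qed

lemma u_elt_eq:
  assumes lam: "lam \<in> multipartitions l n"
  shows "u_elt l n u lam = hclass l n u (prod_list (map (\<lambda>s.
    prod_list (map (\<lambda>k. fL k - fscal (u s)) [1..<Suc (acharge lam s)])) [2..<Suc l]))"
proof -
  have k: "fL k \<in> A" if "k \<in> set [1..<Suc (acharge lam s)]" for k s
  proof -
    have "k \<in> {1..acharge lam s}" using that by (simp only: set_upt atLeastLessThanSuc_atLeastAtMost)
    then show ?thesis using acharge_le[OF lam, of s] by (intro A_closed) auto
  qed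
  have inner: "hprod l n u (map (\<lambda>k. hL l n u k \<ominus>\<^bsub>H\<^esub> hscal l n u (u s)) [1..<Suc (acharge lam s)])
      = hclass l n u (prod_list (map (\<lambda>k. fL k - fscal (u s)) [1..<Suc (acharge lam s)]))" for s
  proof -
    have "map (\<lambda>k. hL l n u k \<ominus>\<^bsub>H\<^esub> hscal l n u (u s)) [1..<Suc (acharge lam s)]
        = map (\<lambda>k. hclass l n u (fL k - fscal (u s))) [1..<Suc (acharge lam s)]"
      unfolding hL_def hscal_def by (intro map_cong HOL.refl hclass_diff k A_closed)
    then show ?thesis by (simp only:) (intro hclass_prod_list A_closed k)
  qed
  show ?thesis
    unfolding u_elt_def inner by (intro hclass_prod_list prod_list_A A_closed k)
qed

text \<open>By linearity the form is evaluated on each summand \<open>w\<close> of the row sum, a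
  case of \<open>T_sandwich\<close>. Functions compose in the order opposite to the right action, so
  the product \<open>w d(t)\<close> appears as \<open>tab_perm lam t \<circ> w\<close>.\<close>

lemma murphy_value:
  assumes lam: "lam \<in> multipartitions l n" and st: "s \<in> Std lam" "t \<in> Std lam"
  shows "\<tau> (murphy l n u lam s t) = (\<Sum>w\<in>young_subgroup (concat lam).
    if (\<forall>k\<in>{2..l}. acharge lam k = n) \<and> tab_perm lam t \<circ> w = tab_perm lam s then 1 else 0)"
proof -
  let ?Y = "young_subgroup (concat lam)"
  define U where "U = prod_list (map (\<lambda>s.
    prod_list (map (\<lambda>k. fL k - fscal (u s)) [1..<Suc (acharge lam s)])) [2..<Suc l])"
  define xs where "xs = rev (pword n (tab_perm lam s))"
  define ys where "ys = pword n (tab_perm lam t)"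
  note p = tab_perm(1)[OF lam st(1)] tab_perm(1)[OF lam st(2)]
  have xs: "set xs \<subseteq> {1..<n}" using pword(1)[OF p(1)] by (simp add: xs_def)
  have ys: "set ys \<subseteq> {1..<n}" using pword(1)[OF p(2)] by (simp add: ys_def)
  have pw: "set (pword n w) \<subseteq> {1..<n}" "word_perm (pword n w) = w" if "w \<in> ?Y" for w
    using pword[OF young_subgroup_permutes[OF lam that]] by auto
  have UA: "U \<in> A"
    unfolding U_def by (rule T_sandwich(1)[OF acharge_le[OF lam] xs ys])
  have XA: "(\<Sum>w\<in>?Y. sword (pword n w)) \<in> A"
    using pw by (intro sum_A sword_A)
  have s: "hstar (hperm l n u (tab_perm lam s)) = hclass l n u (sword xs)"
    by (simp only: hperm_eq[OF p(1)] hstar_hclass[OF n_pos] frev_sword xs_def)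
  have t: "hperm l n u (tab_perm lam t) = hclass l n u (sword ys)"
    by (simp only: hperm_eq[OF p(2)] ys_def)
  have m: "m_elt l n u lam = hclass l n u ((\<Sum>w\<in>?Y. sword (pword n w)) * U)"
    unfolding m_elt_def x_elt_eq[OF lam] u_elt_eq[OF lam] U_def[symmetric] by (rule hclass_mult[OF XA UA])
  have "murphy l n u lam s t = hclass l n u (sword xs * ((\<Sum>w\<in>?Y. sword (pword n w)) * U) * sword ys)"
    unfolding murphy_def s t m
    by (simp only: hclass_mult sword_A[OF xs] sword_A[OF ys] A_closed(2) XA UA)
  also have "sword xs * ((\<Sum>w\<in>?Y. sword (pword n w)) * U) * sword ys
      = (\<Sum>w\<in>?Y. sword (xs @ pword n w) * U * sword ys)"
    by (simp add: sum_distrib_left sum_distrib_right mult.assoc)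
  finally have "\<tau> (murphy l n u lam s t) = T (\<Sum>w\<in>?Y. sword (xs @ pword n w) * U * sword ys)"
    by (simp only: T_def)
  also have "\<dots> = (\<Sum>w\<in>?Y. T (sword (xs @ pword n w) * U * sword ys))"
    using xs ys pw UA by (intro T_sum A_closed sword_A) auto
  also have "\<dots> = (\<Sum>w\<in>?Y.
    if (\<forall>k\<in>{2..l}. acharge lam k = n) \<and> tab_perm lam t \<circ> w = tab_perm lam s then 1 else 0)"
  proof (rule sum.cong[OF HOL.refl])
    fix w assume w: "w \<in> ?Y"
    have "T (sword (xs @ pword n w) * U * sword ys)
      = (if (\<forall>k\<in>{2..l}. acharge lam k = n) \<and> word_perm ((xs @ pword n w) @ ys) = id then 1 else 0)"
      unfolding U_def using xs ys pw[OF w] by (intro T_sandwich(2) acharge_le[OF lam]) auto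
    moreover have "word_perm ((xs @ pword n w) @ ys) = tab_perm lam t \<circ> w \<circ> word_perm xs"
      by (simp add: word_perm_append pw(2)[OF w] ys_def pword(2)[OF p(2)] o_assoc)
    \<comment> \<open>The reversed word \<open>xs\<close> represents the inverse of
      \<open>d(s)\<close>, so the triviality condition becomes an equation between
      \<open>w d(t)\<close> and \<open>d(s)\<close>.\<close>
    moreover have "word_perm xs \<circ> tab_perm lam s = id" "tab_perm lam s \<circ> word_perm xs = id"
      using word_perm_rev[of "pword n (tab_perm lam s)"] word_perm_rev[of xs] pword(2)[OF p(1)]
      by (simp_all add: xs_def)
    then have "tab_perm lam t \<circ> w \<circ> word_perm xs = id \<longleftrightarrow> tab_perm lam t \<circ> w = tab_perm lam s"
      by (metis comp_assoc comp_id id_comp)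
    ultimately show "T (sword (xs @ pword n w) * U * sword ys)
      = (if (\<forall>k\<in>{2..l}. acharge lam k = n) \<and> tab_perm lam t \<circ> w = tab_perm lam s then 1 else 0)"
      by (simp only:)
  qed
  finally show ?thesis .
qed

end

theorem theorem1p10:
  fixes \<l> n :: nat
    and u :: "nat \<Rightarrow> 'r::idom"
    and \<tau> :: "'r free_alg set \<Rightarrow> 'r"
    and lam :: "nat list list"
    and s t :: "node \<Rightarrow> nat"
  assumes "\<l> \<ge> 1" and "n \<ge> 1"
    and "is_BK_form \<l> n u \<tau>"
    and "lam \<in> multipartitions \<l> n"
    and "s \<in> Std lam" and "t \<in> Std lam"
  shows "\<tau> (murphy \<l> n u lam s t) =
           (if s = t \<and> (\<forall>i \<in> {1..n}. tab_comp lam t i = 1) then 1 else 0)"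
proof -
  interpret BK_form \<l> n u \<tau> using assms by unfold_locales
  let ?Y = "young_subgroup (concat lam)" and ?all = "\<forall>k\<in>{2..\<l>}. acharge lam k = n"
  note lam = assms(4)
  have all: "(\<forall>i\<in>{1..n}. tab_comp lam t i = 1) \<longleftrightarrow> ?all"
    using tab_comp_eq_1_iff[OF lam assms(6)] single_component_iff_acharge[OF lam] by simp
  have eq: "tab_perm lam t \<circ> w = tab_perm lam s \<longleftrightarrow> s = t \<and> w = id" if ?all "w \<in> ?Y" for w
  proof
    assume w: "tab_perm lam t \<circ> w = tab_perm lam s"
    have "s = t"
      using Std_eq_if_young[OF lam assms(5,6) _ that(2) w] single_component_iff_acharge[OF lam] that(1) by simp
    moreover have "w = id"
    proof
      fix x
      have "tab_perm lam t (w x) = tab_perm lam t x"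
        using fun_cong[OF w, of x] \<open>s = t\<close> by simp
      then show "w x = id x"
        using injD[OF permutes_inj[OF tab_perm(1)[OF lam assms(6)]]] by simp
    qed
    ultimately show "s = t \<and> w = id" ..
  qed simp
  \<comment> \<open>The identity lies in the Young subgroup, so exactly one summand survives when
    \<open>P\<close> holds.\<close>
  have delta: "(\<Sum>w\<in>?Y. if P \<and> w = id then 1 else 0 :: 'r) = (if P then 1 else 0)" for P
    using finite_young_subgroup[of "concat lam"]
    by (cases P) (simp_all, simp add: young_subgroup_def permutes_def)
  have "\<tau> (murphy \<l> n u lam s t) = (\<Sum>w\<in>?Y. if (s = t \<and> ?all) \<and> w = id then 1 else 0)"
    unfolding murphy_value[OF lam assms(5,6)] using eq by (intro sum.cong) auto
  also have "\<dots> = (if s = t \<and> ?all then 1 else 0)" by (rule delta)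
  finally show ?thesis unfolding all .
qed

end
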